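(* Consider the problem $\min_{u\in\mathbb{R}^d} G(u)$ subject to $Bu=b$, where $B\in\mathbb{R}^{s\times d}$ is nonzero and $b$ lies in the column space of $B$. Let $G$ be convex, $L$-smooth and $\mu$-strongly convex with $0\le \mu<L$ (where $\mu=0$ means merely convex). Let $u^*$ be a solution, let $u^0$ satisfy $\|u^0-u^*\|^2\le R^2$, and let $\varepsilon>0$. Write $\kappa_B=\sigma_{\max}^2(B)/\sigma_{\min^+}^2(B)$. 1. (Strongly convex case, $\mu>0$.) There exists a choice of parameters $\eta,\theta,\alpha>0$, $\tau\in(0,1)$ for APAPC such that after $N=O\big(\kappa_B\sqrt{L/\mu}\,\log(1/\varepsilon)\big)$ iterations the output $u^N$ satisfies $\|u^N-u^*\|^2\le\varepsilon$. 2. (Convex case, $\mu=0$.) Applying APAPC (with suitable parameters) to the regularized function $G^{\nu}(u)=G(u)+\frac{\nu}{2}\|u^0-u\|^2$ with $\nu=\varepsilon/R^2$ under the same constraint $Bu=b$, after $N=O\big(\kappa_B\sqrt{LR^2/\varepsilon}\,\log(1/\varepsilon)\big)$ iterations one obtains $u^N$ with $G(u^N)-G(u^* )\le\varepsilon$ and $\|Bu^N-b\|^2\le O(\sigma_{\max}^2(B)\varepsilon^2)$.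
   Context: $\sigma_{\max}(B)$ and $\sigma_{\min^+}(B)$ denote the largest and the smallest positive singular values of $B$. $G$ is $L$-smooth if it is differentiable and $G(u')-G(u)-\langle\nabla G(u),u'-u\rangle\le\frac L2\|u'-u\|^2$ for all $u,u'$; it is $\mu$-strongly convex if $G(u')\ge G(u)+\langle\nabla G(u),u'-u\rangle+\frac\mu2\|u'-u\|^2$ for all $u,u'$. APAPC (Accelerated Proximal Alternating Predictor–Corrector) for $\min G(u)$ s.t. $Bu=b$, with input $u^0$ and parameters $\eta,\theta,\alpha>0$, $\tau\in(0,1)$, $N\in\mathbb{N}$: set $u_f^0=u^0$, $z^0=0$; for $k=0,\dots,N-1$: $u_g^k=\tau u^k+(1-\tau)u_f^k$; $u^{k+1/2}=(1+\eta\alpha)^{-1}(u^k-\eta(\nabla G(u_g^k)-\alpha u_g^k+z^k))$; $z^{k+1}=z^k+\theta B^\top(Bu^{k+1/2}-b)$; $u^{k+1}=(1+\eta\alpha)^{-1}(u^k-\eta(\nabla G(u_g^k)-\alpha u_g^k+z^{k+1}))$; $u_f^{k+1}=u_g^k+\frac{2\tau}{2-\tau}(u^{k+1}-u^k)$; output $u^N$. *)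

theory Defs
  imports "HOL-Analysis.Analysis"
begin

text \<open>Vectors of R^n are represented as functions nat => real that vanish
  outside the index range 0..<n; matrices in R^(s x d) as nat => nat => real
  (only entries i < s, j < d are used).  This lets the dimensions d, s be
  ordinary numbers, so that the absolute constant in the O-bounds can be
  quantified uniformly over all dimensions.\<close>

definition vecs :: "nat \<Rightarrow> (nat \<Rightarrow> real) set" where
  "vecs n = {x. \<forall>i\<ge>n. x i = 0}"

definition ip :: "nat \<Rightarrow> (nat \<Rightarrow> real) \<Rightarrow> (nat \<Rightarrow> real) \<Rightarrow> real" where
  "ip n x y = (\<Sum>i<n. x i * y i)"

definition nrm_sq :: "nat \<Rightarrow> (nat \<Rightarrow> real) \<Rightarrow> real" where
  "nrm_sq n x = ip n x x"

definition nrm :: "nat \<Rightarrow> (nat \<Rightarrow> real) \<Rightarrow> real" where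
  "nrm n x = sqrt (nrm_sq n x)"

definition mv :: "nat \<Rightarrow> nat \<Rightarrow> (nat \<Rightarrow> nat \<Rightarrow> real) \<Rightarrow> (nat \<Rightarrow> real) \<Rightarrow> (nat \<Rightarrow> real)" where
  "mv s d B x = (\<lambda>i. if i < s then (\<Sum>j<d. B i j * x j) else 0)"

definition mtv :: "nat \<Rightarrow> nat \<Rightarrow> (nat \<Rightarrow> nat \<Rightarrow> real) \<Rightarrow> (nat \<Rightarrow> real) \<Rightarrow> (nat \<Rightarrow> real)" where
  "mtv s d B y = (\<lambda>j. if j < d then (\<Sum>i<s. B i j * y i) else 0)"

definition singular_values :: "nat \<Rightarrow> nat \<Rightarrow> (nat \<Rightarrow> nat \<Rightarrow> real) \<Rightarrow> real set" where
  "singular_values s d B = {\<sigma>. \<sigma> \<ge> 0 \<and>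
     (\<exists>x\<in>vecs d. x \<noteq> (\<lambda>_. 0) \<and> mtv s d B (mv s d B x) = (\<lambda>i. \<sigma>\<^sup>2 * x i))}"

definition sigma_max :: "nat \<Rightarrow> nat \<Rightarrow> (nat \<Rightarrow> nat \<Rightarrow> real) \<Rightarrow> real" where
  "sigma_max s d B = Max (singular_values s d B)"

definition sigma_min_pos :: "nat \<Rightarrow> nat \<Rightarrow> (nat \<Rightarrow> nat \<Rightarrow> real) \<Rightarrow> real" where
  "sigma_min_pos s d B = Min {\<sigma> \<in> singular_values s d B. \<sigma> > 0}"

definition kappa_B :: "nat \<Rightarrow> nat \<Rightarrow> (nat \<Rightarrow> nat \<Rightarrow> real) \<Rightarrow> real" where
  "kappa_B s d B = (sigma_max s d B)\<^sup>2 / (sigma_min_pos s d B)\<^sup>2"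

text \<open>g is the gradient of G at u (Frechet derivative on R^d).  The function
  space nat => real carries the product topology, which on vecs d is the
  Euclidean topology.\<close>
definition has_grad :: "nat \<Rightarrow> ((nat \<Rightarrow> real) \<Rightarrow> real) \<Rightarrow> (nat \<Rightarrow> real) \<Rightarrow> (nat \<Rightarrow> real) \<Rightarrow> bool" where
  "has_grad d G g u \<longleftrightarrow> g \<in> vecs d \<and>
     ((\<lambda>h. (G (\<lambda>i. u i + h i) - G u - ip d g h) / nrm d h) \<longlongrightarrow> 0) (at (\<lambda>_. 0) within vecs d)"

definition convex_fn :: "nat \<Rightarrow> ((nat \<Rightarrow> real) \<Rightarrow> real) \<Rightarrow> bool" where
  "convex_fn d G \<longleftrightarrow> (\<forall>x\<in>vecs d. \<forall>y\<in>vecs d. \<forall>t::real. 0 \<le> t \<and> t \<le> 1 \<longrightarrow>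
      G (\<lambda>i. t * x i + (1 - t) * y i) \<le> t * G x + (1 - t) * G y)"

definition L_smooth :: "nat \<Rightarrow> ((nat \<Rightarrow> real) \<Rightarrow> real) \<Rightarrow> ((nat \<Rightarrow> real) \<Rightarrow> (nat \<Rightarrow> real)) \<Rightarrow> real \<Rightarrow> bool" where
  "L_smooth d G gG L \<longleftrightarrow> (\<forall>u\<in>vecs d. has_grad d G (gG u) u) \<and>
     (\<forall>u\<in>vecs d. \<forall>u'\<in>vecs d.
        G u' - G u - ip d (gG u) (\<lambda>i. u' i - u i) \<le> L / 2 * nrm_sq d (\<lambda>i. u' i - u i))"

definition strongly_convex :: "nat \<Rightarrow> ((nat \<Rightarrow> real) \<Rightarrow> real) \<Rightarrow> ((nat \<Rightarrow> real) \<Rightarrow> (nat \<Rightarrow> real)) \<Rightarrow> real \<Rightarrow> bool" where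
  "strongly_convex d G gG \<mu> \<longleftrightarrow>
     (\<forall>u\<in>vecs d. \<forall>u'\<in>vecs d.
        G u' \<ge> G u + ip d (gG u) (\<lambda>i. u' i - u i) + \<mu> / 2 * nrm_sq d (\<lambda>i. u' i - u i))"

definition problem_setting where
  "problem_setting d s B b G gG L \<mu> ustar \<longleftrightarrow>
     (\<exists>i<s. \<exists>j<d. B i j \<noteq> 0) \<and>
     b \<in> vecs s \<and> (\<exists>x\<in>vecs d. mv s d B x = b) \<and>
     convex_fn d G \<and> L_smooth d G gG L \<and> strongly_convex d G gG \<mu> \<and>
     0 \<le> \<mu> \<and> \<mu> < L \<and>
     ustar \<in> vecs d \<and> mv s d B ustar = b \<and>
     (\<forall>u\<in>vecs d. mv s d B u = b \<longrightarrow> G ustar \<le> G u)"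

text \<open>One APAPC iteration; state (u^k, u_f^k, z^k); gG is the gradient oracle.\<close>
definition apapc_step where
  "apapc_step s d B b gG \<eta> \<theta> \<alpha> \<tau> st =
    (let (u, uf, z) = st;
         ug = (\<lambda>i. \<tau> * u i + (1 - \<tau>) * uf i);
         g = gG ug;
         uh = (\<lambda>i. (u i - \<eta> * (g i - \<alpha> * ug i + z i)) / (1 + \<eta> * \<alpha>));
         r = (\<lambda>i. mv s d B uh i - b i);
         z' = (\<lambda>i. z i + \<theta> * mtv s d B r i);
         u' = (\<lambda>i. (u i - \<eta> * (g i - \<alpha> * ug i + z' i)) / (1 + \<eta> * \<alpha>));
         uf' = (\<lambda>i. ug i + 2 * \<tau> / (2 - \<tau>) * (u' i - u i))
     in (u', uf', z'))"

fun apapc_iter where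
  "apapc_iter s d B b gG \<eta> \<theta> \<alpha> \<tau> u0 0 = (u0, u0, (\<lambda>_. 0))"
| "apapc_iter s d B b gG \<eta> \<theta> \<alpha> \<tau> u0 (Suc k) =
     apapc_step s d B b gG \<eta> \<theta> \<alpha> \<tau> (apapc_iter s d B b gG \<eta> \<theta> \<alpha> \<tau> u0 k)"

definition apapc where
  "apapc s d B b gG \<eta> \<theta> \<alpha> \<tau> u0 N = fst (apapc_iter s d B b gG \<eta> \<theta> \<alpha> \<tau> u0 N)"

end

theory Submission
  imports Defs
begin

text \<open>
  With \<open>\<alpha> = \<mu>\<close>, \<open>\<tau> = sqrt (\<mu> / L) / 2\<close>, \<open>\<eta> = 1 / (4 \<tau> L)\<close> and \<open>\<theta> = 1 / (\<eta> sigma_max\<^sup>2)\<close> a Lyapunov function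
  contracts by the factor \<open>1 / (1 + \<tau> / (3 \<kappa>))\<close> in every step. It combines the squared distance of
  \<open>u\<close> to the solution, the Bregman distance of \<open>u\<^sub>f\<close> to the solution, and a dual distance.
  Since \<open>z\<close> always lies in the range of the Gram matrix \<open>B\<^sup>T B\<close>, it is written as \<open>z = B\<^sup>T B w\<close>, and
  the optimal multiplier \<open>- \<nabla>G(u\<^sup>*)\<close>, being orthogonal to the kernel of \<open>B\<close>, as \<open>B\<^sup>T B w\<^sup>*\<close>; the dual
  distance is a quadratic form in \<open>w - w\<^sup>*\<close>. Its decay comes from the terms that the descent inequality
  leaves over: by the update formula for \<open>u\<close> they dominate \<open>|z - z\<^sup>*|\<^sup>2\<close>, hence the dual distance up to
  the factor \<open>\<kappa>\<close>. In the merely convex case the initial Lyapunov value of the regularised problem grows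
  only polynomially in \<open>1 / \<epsilon>\<close>, which costs a constant factor in the number of iterations.
\<close>

section \<open>Vectors and matrices\<close>

lemma vecs_closed [simp, intro]:
  "(\<lambda>_. 0) \<in> vecs d"
  "x \<in> vecs d \<Longrightarrow> y \<in> vecs d \<Longrightarrow> (\<lambda>i. x i + y i) \<in> vecs d"
  "x \<in> vecs d \<Longrightarrow> y \<in> vecs d \<Longrightarrow> (\<lambda>i. x i - y i) \<in> vecs d"
  "x \<in> vecs d \<Longrightarrow> (\<lambda>i. c * x i) \<in> vecs d"
  "x \<in> vecs d \<Longrightarrow> (\<lambda>i. x i / c) \<in> vecs d"
  "mv s d B x \<in> vecs s"
  "mtv s d B y \<in> vecs d"
  by (auto simp: vecs_def mv_def mtv_def)

lemma vecs_sum [intro]: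
  "(\<And>k. k \<in> I \<Longrightarrow> e k \<in> vecs d) \<Longrightarrow> (\<lambda>j. \<Sum>k\<in>I. c k * e k j) \<in> vecs d"
  by (auto simp: vecs_def)

lemma ip_commute: "ip d x y = ip d y x"
  by (simp add: ip_def mult.commute)

lemma ip_left:
  "ip d (\<lambda>i. x i + y i) z = ip d x z + ip d y z"
  "ip d (\<lambda>i. x i - y i) z = ip d x z - ip d y z"
  "ip d (\<lambda>i. c * x i) z = c * ip d x z"
  by (simp_all add: ip_def algebra_simps sum.distrib sum_subtractf sum_distrib_left)

lemma ip_right:
  "ip d z (\<lambda>i. x i + y i) = ip d z x + ip d z y"
  "ip d z (\<lambda>i. x i - y i) = ip d z x - ip d z y"
  "ip d z (\<lambda>i. c * x i) = c * ip d z x"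
  by (simp_all add: ip_def algebra_simps sum.distrib sum_subtractf sum_distrib_left)

lemma ip_sum_left: "ip d (\<lambda>j. \<Sum>k\<in>I. c k * e k j) z = (\<Sum>k\<in>I. c k * ip d (e k) z)"
  unfolding ip_def sum_distrib_right sum_distrib_left
  by (subst sum.swap) (simp add: mult.assoc)

lemma nrm_sq_nonneg [simp]: "0 \<le> nrm_sq d x"
  by (simp add: nrm_sq_def ip_def sum_nonneg)

lemma nrm_sq_eq_0_iff: "x \<in> vecs d \<Longrightarrow> nrm_sq d x = 0 \<longleftrightarrow> x = (\<lambda>_. 0)"
  by (auto simp: nrm_sq_def ip_def sum_nonneg_eq_0_iff vecs_def fun_eq_iff)
    (meson lessThan_iff not_less)

lemma nrm_sq_scale: "nrm_sq d (\<lambda>i. c * x i) = c\<^sup>2 * nrm_sq d x"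
  by (simp add: nrm_sq_def ip_left ip_right power2_eq_square)

lemma nrm_sq_add: "nrm_sq d (\<lambda>i. x i + y i) = nrm_sq d x + 2 * ip d x y + nrm_sq d y"
  by (simp add: nrm_sq_def ip_left ip_right ip_commute[of d y x])

lemma nrm_sq_diff: "nrm_sq d (\<lambda>i. x i - y i) = nrm_sq d x - 2 * ip d x y + nrm_sq d y"
  by (simp add: nrm_sq_def ip_left ip_right ip_commute[of d y x])

lemma ip_le_nrm_sq: "ip d x y \<le> (nrm_sq d x + nrm_sq d y) / 2"
  using nrm_sq_nonneg[of d "\<lambda>i. x i - y i"] by (simp add: nrm_sq_diff)

lemma nrm_sq_add_le: "nrm_sq d (\<lambda>i. x i + y i) \<le> 2 * nrm_sq d x + 2 * nrm_sq d y"
  using ip_le_nrm_sq[of d x y] by (simp add: nrm_sq_add)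

lemma mv_linear:
  "mv s d B (\<lambda>i. x i + y i) = (\<lambda>i. mv s d B x i + mv s d B y i)"
  "mv s d B (\<lambda>i. x i - y i) = (\<lambda>i. mv s d B x i - mv s d B y i)"
  "mv s d B (\<lambda>i. c * x i) = (\<lambda>i. c * mv s d B x i)"
  by (auto simp: mv_def algebra_simps sum.distrib sum_subtractf sum_distrib_left fun_eq_iff)

lemma mv_zero [simp]: "mv s d B (\<lambda>_. 0) = (\<lambda>_. 0)"
  by (auto simp: mv_def)

lemma mtv_linear:
  "mtv s d B (\<lambda>i. x i + y i) = (\<lambda>i. mtv s d B x i + mtv s d B y i)"
  "mtv s d B (\<lambda>i. x i - y i) = (\<lambda>i. mtv s d B x i - mtv s d B y i)"
  "mtv s d B (\<lambda>i. c * x i) = (\<lambda>i. c * mtv s d B x i)"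
  by (auto simp: mtv_def algebra_simps sum.distrib sum_subtractf sum_distrib_left fun_eq_iff)

lemma mtv_zero [simp]: "mtv s d B (\<lambda>_. 0) = (\<lambda>_. 0)"
  by (auto simp: mtv_def)

lemma mtv_adjoint: "ip d (mtv s d B y) x = ip s y (mv s d B x)"
proof -
  have "ip d (mtv s d B y) x = (\<Sum>j<d. \<Sum>i<s. B i j * y i * x j)"
    by (simp add: ip_def mtv_def sum_distrib_right)
  also have "\<dots> = (\<Sum>i<s. \<Sum>j<d. B i j * y i * x j)"
    by (rule sum.swap)
  also have "\<dots> = ip s y (mv s d B x)"
    by (simp add: ip_def mv_def sum_distrib_left algebra_simps)
  finally show ?thesis .
qed

lemma gram_symmetric:
  "ip d (mtv s d B (mv s d B x)) y = ip d x (mtv s d B (mv s d B y))"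
  by (metis mtv_adjoint ip_commute)

section \<open>Continuity and compactness in the coordinate space\<close>

lemma continuous_on_ip [continuous_intros]:
  fixes f g :: "(nat \<Rightarrow> real) \<Rightarrow> (nat \<Rightarrow> real)"
  assumes "\<And>i. continuous_on S (\<lambda>x. f x i)" "\<And>i. continuous_on S (\<lambda>x. g x i)"
  shows "continuous_on S (\<lambda>x. ip d (f x) (g x))"
  unfolding ip_def by (intro continuous_intros assms)

lemma continuous_on_coordinate [continuous_intros]:
  "continuous_on S (\<lambda>x :: nat \<Rightarrow> real. x i)"
  by (rule continuous_on_subset[OF continuous_on_product_coordinates]) simp

lemma continuous_on_mv [continuous_intros]:
  "continuous_on S (\<lambda>x. mv s d B x i)"
  by (cases "i < s") (auto simp: mv_def intro!: continuous_intros)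

lemma closed_vecs: "closed (vecs d)"
proof -
  have "vecs d = (\<Inter>i\<in>{d..}. {x. x i = 0})"
    by (auto simp: vecs_def)
  moreover have "closed {x :: nat \<Rightarrow> real. x i = 0}" for i
    by (intro closed_Collect_eq continuous_intros)
  ultimately show ?thesis by auto
qed

text \<open>The box \<open>T\<close> is compact in the product topology by Tychonoff. The norm bound
  confines the coordinates below \<open>d\<close> to \<open>[-sqrt M, sqrt M]\<close> and the others
  are zero, so \<open>S\<close> is a closed subset of the box.\<close>

lemma compact_bounded_vecs:
  assumes "closed S" "S \<subseteq> vecs d" "\<And>x. x \<in> S \<Longrightarrow> nrm_sq d x \<le> M"
  shows "compact S"
proof -
  define T where "T = PiE UNIV (\<lambda>i::nat. {-sqrt M..sqrt M :: real})"
  have "compactin (product_topology (\<lambda>_. euclidean) UNIV) T"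
    unfolding T_def by (subst compactin_PiE) auto
  then have T: "compact T"
    by (simp add: euclidean_product_topology)
  have "S \<subseteq> T"
  proof
    fix x assume x: "x \<in> S"
    have "\<bar>x i\<bar> \<le> sqrt M" for i
    proof (cases "i < d")
      case True
      then have "(x i)\<^sup>2 \<le> nrm_sq d x"
        unfolding nrm_sq_def ip_def power2_eq_square
        by (intro member_le_sum[where f="\<lambda>i. x i * x i"]) auto
      also have "\<dots> \<le> M" by (rule assms(3)[OF x])
      finally show ?thesis by (rule real_le_rsqrt[of "\<bar>x i\<bar>", simplified])
    next
      case False
      then have "x i = 0" using assms(2) x by (auto simp: vecs_def)
      moreover have "0 \<le> M" using assms(3)[OF x] nrm_sq_nonneg[of d x] by linarith
      ultimately show ?thesis by simp
    qed
    then show "x \<in> T" by (auto simp: T_def abs_le_iff minus_le_iff)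
  qed
  then have "S = T \<inter> S" by auto
  then show ?thesis using compact_Int_closed[OF T assms(1)] by simp
qed

section \<open>The spectral decomposition of the Gram matrix\<close>

text \<open>First-order optimality in one variable. It serves twice: for the Rayleigh quotient at
  its maximiser and for the objective at a minimiser along kernel directions.\<close>

lemma linear_coefficient_zero:
  fixes a c :: real
  assumes "\<And>t. 0 \<le> 2 * t * a + t\<^sup>2 * c"
  shows "a = 0"
proof (rule ccontr)
  assume a: "a \<noteq> 0"
  \<comment> \<open>With this \<open>t\<close> the quadratic term is at most \<open>- t * a\<close>,
    half the size of the linear term, so the sum is at most \<open>t * a\<close>, which is
    negative.\<close>
  define t where "t = - a / (\<bar>c\<bar> + 1)"
  have "t\<^sup>2 * c \<le> t\<^sup>2 * (\<bar>c\<bar> + 1)" by (intro mult_left_mono) auto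
  also have "\<dots> = - t * a" by (simp add: t_def power2_eq_square)
  finally have "0 \<le> t * a" using assms[of t] by linarith
  moreover have "t * a < 0" using a
    by (simp add: t_def divide_less_0_iff not_less power2_eq_square[symmetric])
  ultimately show False by simp
qed

text \<open>A partial orthonormal eigenbasis of the Gram matrix. Its length \<open>n\<close> is a
  parameter so that a family of greatest length can be chosen.\<close>

definition eigenfamily ::
  "nat \<Rightarrow> nat \<Rightarrow> (nat \<Rightarrow> nat \<Rightarrow> real) \<Rightarrow> nat \<Rightarrow> (nat \<Rightarrow> nat \<Rightarrow> real) \<Rightarrow> (nat \<Rightarrow> real) \<Rightarrow> bool" where
  "eigenfamily s d B n e \<omega> \<longleftrightarrow>
     (\<forall>k<n. e k \<in> vecs d \<and> mtv s d B (mv s d B (e k)) = (\<lambda>i. \<omega> k * e k i)) \<and>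
     (\<forall>k<n. \<forall>l<n. ip d (e k) (e l) = (if k = l then 1 else (0::real)))"

lemma orthonormal_residual:
  fixes n :: nat
  assumes "\<forall>k<n. \<forall>l<n. ip d (e k) (e l) = (if k = l then 1 else (0::real))" "l < n"
  shows "ip d (\<lambda>j. x j - (\<Sum>k<n. ip d x (e k) * e k j)) (e l) = 0"
proof -
  have "(\<Sum>k<n. ip d x (e k) * ip d (e k) (e l)) = (\<Sum>k<n. if k = l then ip d x (e k) else 0)"
    using assms by (intro sum.cong) auto
  also have "\<dots> = ip d x (e l)" using assms(2) by (simp add: sum.delta)
  finally show ?thesis by (simp add: ip_left ip_sum_left)
qed

text \<open>The projection \<open>p\<close> is orthogonal to the residual \<open>x - p\<close>, so
  the squared norm of the residual is \<open>nrm_sq d x - nrm_sq d p\<close>.\<close>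

lemma Bessel:
  fixes n :: nat
  assumes "\<forall>k<n. \<forall>l<n. ip d (e k) (e l) = (if k = l then 1 else (0::real))"
  shows "(\<Sum>k<n. (ip d x (e k))\<^sup>2) \<le> nrm_sq d x"
proof -
  define p where "p = (\<lambda>j. \<Sum>k<n. ip d x (e k) * e k j)"
  have r: "ip d (\<lambda>j. x j - p j) (e l) = 0" if "l < n" for l
    unfolding p_def by (rule orthonormal_residual[OF assms that])
  have "ip d p (\<lambda>j. x j - p j) = 0"
    using r by (subst p_def, subst ip_sum_left) (simp add: ip_commute[of d "e _"])
  then have "ip d p x = nrm_sq d p" by (simp add: ip_right nrm_sq_def)
  moreover have "ip d p x = (\<Sum>k<n. (ip d x (e k))\<^sup>2)"
    unfolding p_def by (simp add: ip_sum_left ip_commute[of d "e _"] power2_eq_square)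
  moreover have "0 \<le> nrm_sq d (\<lambda>j. x j - p j)" by simp
  ultimately show ?thesis by (simp add: nrm_sq_diff ip_commute[of d x p])
qed

text \<open>Count the squared entries of all \<open>e k\<close> in two ways: by vectors they sum to
  \<open>n\<close>; by coordinates each of the \<open>d\<close> sums is at most 1, by Bessel for the
  unit vector \<open>\<delta>\<close>.\<close>

lemma eigenfamily_length:
  assumes "eigenfamily s d B n e \<omega>"
  shows "n \<le> d"
proof -
  have on: "\<forall>k<n. \<forall>l<n. ip d (e k) (e l) = (if k = l then 1 else (0::real))"
    using assms by (simp add: eigenfamily_def)
  have "real n = (\<Sum>k<n. ip d (e k) (e k))" using on by simp
  also have "\<dots> = (\<Sum>j<d. \<Sum>k<n. (e k j)\<^sup>2)"
    unfolding ip_def by (subst sum.swap) (simp add: power2_eq_square)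
  also have "\<dots> \<le> (\<Sum>j<d. 1)"
  proof (intro sum_mono)
    fix j assume j: "j \<in> {..<d}"
    define \<delta> :: "nat \<Rightarrow> real" where "\<delta> = (\<lambda>i. if i = j then 1 else 0)"
    have "ip d \<delta> x = x j" for x
    proof -
      have "ip d \<delta> x = (\<Sum>i<d. if i = j then x i else 0)"
        unfolding ip_def \<delta>_def by (intro sum.cong) auto
      then show ?thesis using j by (simp add: sum.delta)
    qed
    then show "(\<Sum>k<n. (e k j)\<^sup>2) \<le> 1"
      using Bessel[OF on, of \<delta>] by (simp add: nrm_sq_def \<delta>_def)
  qed
  finally show ?thesis by simp
qed

text \<open>A maximiser of the Rayleigh quotient on the orthogonal complement of the family is an
  eigenvector, because the complement is invariant.\<close>

lemma eigenfamily_extend: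
  assumes E: "eigenfamily s d B n e \<omega>"
    and x0: "x0 \<in> vecs d" "x0 \<noteq> (\<lambda>_. 0)" "\<And>k. k < n \<Longrightarrow> ip d x0 (e k) = 0"
  shows "\<exists>e \<omega>. eigenfamily s d B (Suc n) e \<omega>"
proof -
  define A where "A x = mtv s d B (mv s d B x)" for x
  define S where "S = {x \<in> vecs d. \<forall>k<n. ip d x (e k) = 0}"
  define U where "U = S \<inter> {x. nrm_sq d x = 1}"
  have "closed U"
  proof -
    have "U = vecs d \<inter> (\<Inter>k\<in>{..<n}. {x. ip d x (e k) = 0}) \<inter> {x. nrm_sq d x = 1}"
      by (auto simp: U_def S_def)
    then show ?thesis
      by (auto intro!: closed_Int closed_INT closed_vecs closed_Collect_eq continuous_intros
          simp: nrm_sq_def)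
  qed
  moreover have "U \<subseteq> vecs d" by (auto simp: U_def S_def)
  ultimately have "compact U" by (rule compact_bounded_vecs[where M=1]) (auto simp: U_def)
  have normalise: "(\<lambda>i. (1 / sqrt (nrm_sq d x)) * x i) \<in> U" if "x \<in> S" "x \<noteq> (\<lambda>_. 0)" for x
  proof -
    have "nrm_sq d x > 0"
      using that nrm_sq_eq_0_iff[of x d] nrm_sq_nonneg[of d x] by (simp add: S_def order_less_le)
    then show ?thesis using that(1)
      by (auto simp: U_def S_def ip_left nrm_sq_scale power_divide
          simp del: times_divide_eq_left) simp
  qed
  have "x0 \<in> S" using x0 by (auto simp: S_def)
  then have "U \<noteq> {}" using normalise x0 by blast
  moreover have "continuous_on U (\<lambda>x. nrm_sq s (mv s d B x))"
    unfolding nrm_sq_def by (intro continuous_intros)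
  ultimately obtain v where v: "v \<in> U"
    and vmax: "\<And>x. x \<in> U \<Longrightarrow> nrm_sq s (mv s d B x) \<le> nrm_sq s (mv s d B v)"
    using continuous_attains_sup[OF \<open>compact U\<close>] by blast
  define l where "l = nrm_sq s (mv s d B v)"
  have vS: "v \<in> S" and v1: "nrm_sq d v = 1" using v by (auto simp: U_def)
  have le: "nrm_sq s (mv s d B x) \<le> l * nrm_sq d x" if "x \<in> S" for x
  proof (cases "x = (\<lambda>_. 0)")
    case True then show ?thesis by (simp add: nrm_sq_def ip_def)
  next
    case False
    then have p: "nrm_sq d x > 0"
      using that nrm_sq_eq_0_iff[of x d] nrm_sq_nonneg[of d x] by (simp add: S_def order_less_le)
    from vmax[OF normalise[OF that False]] have "nrm_sq s (mv s d B x) / nrm_sq d x \<le> l"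
      using p unfolding mv_linear nrm_sq_scale l_def by (simp add: power_divide)
    then show ?thesis using p by (simp add: field_simps)
  qed
  have AB: "nrm_sq s (mv s d B x) = ip d (A x) x" for x
    by (simp add: A_def mtv_adjoint nrm_sq_def)
  have "(\<lambda>i. l * v i - A v i) = (\<lambda>_. 0)"
  proof -
    define h where "h = (\<lambda>i. l * v i - A v i)"
    have hS: "h \<in> S"
    proof -
      have "ip d (A v) (e k) = 0" if "k < n" for k
        using E that vS unfolding A_def gram_symmetric by (auto simp: eigenfamily_def S_def ip_right)
      then show ?thesis using vS unfolding h_def S_def by (auto simp: ip_left A_def)
    qed
    \<comment> \<open>This is the Rayleigh inequality \<open>le\<close> at \<open>v + t h\<close>.
      It is an equality at \<open>t = 0\<close>, and the linear coefficient is the inner product of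
      \<open>h\<close> with \<open>l v - A v\<close>, which is \<open>h\<close> itself.\<close>
    have "0 \<le> 2 * t * ip d h h + t\<^sup>2 * (l * nrm_sq d h - ip d (A h) h)" for t
    proof -
      have "(\<lambda>i. v i + t * h i) \<in> S" using vS hS by (auto simp: S_def ip_left)
      from le[OF this] have *: "ip d (A (\<lambda>i. v i + t * h i)) (\<lambda>i. v i + t * h i)
            \<le> l * nrm_sq d (\<lambda>i. v i + t * h i)"
        by (simp add: AB)
      have lin: "A (\<lambda>i. v i + t * h i) = (\<lambda>i. A v i + t * A h i)"
        by (simp add: A_def mv_linear mtv_linear)
      have "ip d (A h) v = ip d (A v) h"
        unfolding A_def using gram_symmetric ip_commute by metis
      moreover have "ip d (A v) v = l" using AB l_def by metis
      moreover have "2 * t * ip d h h = 2 * t * (l * ip d v h) - 2 * t * ip d (A v) h"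
        by (subst (1) h_def) (simp add: ip_left algebra_simps)
      ultimately show ?thesis
        using * unfolding lin nrm_sq_add nrm_sq_scale
        by (simp add: ip_left ip_right v1 algebra_simps power2_eq_square)
    qed
    then have "ip d h h = 0" by (rule linear_coefficient_zero)
    then show ?thesis using nrm_sq_eq_0_iff[of h d] hS
      by (simp add: nrm_sq_def S_def h_def)
  qed
  then have "A v = (\<lambda>i. l * v i)" by (simp add: fun_eq_iff)
  then have "eigenfamily s d B (Suc n) (\<lambda>k. if k = n then v else e k)
      (\<lambda>k. if k = n then l else \<omega> k)"
    using E vS v1 unfolding eigenfamily_def S_def A_def nrm_sq_def
    by (auto simp: less_Suc_eq ip_commute[of d "e _" v])
  then show ?thesis by blast
qed

text \<open>Lengths are bounded by \<open>d\<close>, so a longest family exists. A nonzero residual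
  of some vector after projection would extend it.\<close>

lemma eigenbasis_exists:
  obtains n e \<omega> where "eigenfamily s d B n e \<omega>"
    and "\<And>x. x \<in> vecs d \<Longrightarrow> x = (\<lambda>j. \<Sum>k<n. ip d x (e k) * e k j)"
proof -
  define P where "P n \<longleftrightarrow> (\<exists>e \<omega>. eigenfamily s d B n e \<omega>)" for n
  have P0: "P 0" by (simp add: P_def eigenfamily_def)
  have Pd: "P n \<Longrightarrow> n \<le> d" for n using eigenfamily_length by (auto simp: P_def)
  define n where "n = (GREATEST n. P n)"
  have "P n" unfolding n_def by (rule GreatestI_nat[where b=d and k=0]) (use P0 Pd in auto)
  then obtain e \<omega> where E: "eigenfamily s d B n e \<omega>" by (auto simp: P_def)
  have max: "\<not> P (Suc n)"
  proof
    assume "P (Suc n)"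
    then have "Suc n \<le> n" unfolding n_def by (rule Greatest_le_nat[where b=d]) (use Pd in auto)
    then show False by simp
  qed
  have "x = (\<lambda>j. \<Sum>k<n. ip d x (e k) * e k j)" if x: "x \<in> vecs d" for x
  proof -
    define r where "r = (\<lambda>j. x j - (\<Sum>k<n. ip d x (e k) * e k j))"
    have "r \<in> vecs d"
      unfolding r_def by (intro vecs_closed(3) vecs_sum x) (use E in \<open>auto simp: eigenfamily_def\<close>)
    moreover have "ip d r (e k) = 0" if "k < n" for k
      unfolding r_def using E that by (intro orthonormal_residual) (auto simp: eigenfamily_def)
    ultimately have "r = (\<lambda>_. 0)"
      using eigenfamily_extend[OF E, of r] max by (auto simp: P_def)
    then show ?thesis by (simp add: r_def fun_eq_iff)
  qed
  then show ?thesis using that E by blast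
qed

text \<open>In an eigenbasis the squared norms of \<open>x\<close>, \<open>B x\<close> and
  \<open>B\<^sup>T B x\<close> are sums of the same squared coefficients with weights 1,
  \<open>\<omega> k\<close> and the square of \<open>\<omega> k\<close>. The inequalities then hold
  term by term. The last claim says that the orthogonal complement of the kernel is the range of the
  Gram matrix.\<close>

lemma singular_value_bounds:
  fixes B :: "nat \<Rightarrow> nat \<Rightarrow> real"
  assumes B: "\<exists>i<s. \<exists>j<d. B i j \<noteq> 0"
  shows "0 < sigma_min_pos s d B" "sigma_min_pos s d B \<le> sigma_max s d B"
    and "\<And>x. x \<in> vecs d \<Longrightarrow> nrm_sq s (mv s d B x) \<le> (sigma_max s d B)\<^sup>2 * nrm_sq d x"
    and "\<And>x. x \<in> vecs d \<Longrightarrow>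
      nrm_sq d (mtv s d B (mv s d B x)) \<le> (sigma_max s d B)\<^sup>2 * nrm_sq s (mv s d B x)"
    and "\<And>x. x \<in> vecs d \<Longrightarrow>
      (sigma_min_pos s d B)\<^sup>2 * nrm_sq s (mv s d B x) \<le> nrm_sq d (mtv s d B (mv s d B x))"
    and "\<And>q. q \<in> vecs d \<Longrightarrow> (\<And>x. x \<in> vecs d \<Longrightarrow> mv s d B x = (\<lambda>_. 0) \<Longrightarrow> ip d q x = 0) \<Longrightarrow>
      \<exists>w\<in>vecs d. mtv s d B (mv s d B w) = q"
proof -
  obtain n e \<omega> where E: "eigenfamily s d B n e \<omega>"
    and basis: "\<And>x. x \<in> vecs d \<Longrightarrow> x = (\<lambda>j. \<Sum>k<n. ip d x (e k) * e k j)"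
    using eigenbasis_exists[of s d B] by blast
  define A where "A x = mtv s d B (mv s d B x)" for x
  have ev: "e k \<in> vecs d" and eA: "A (e k) = (\<lambda>i. \<omega> k * e k i)" and e1: "ip d (e k) (e k) = 1"
    if "k < n" for k using E that by (auto simp: eigenfamily_def A_def)
  have parseval: "ip d x y = (\<Sum>k<n. ip d x (e k) * ip d y (e k))" if "x \<in> vecs d" for x y
    by (subst basis[OF that]) (simp add: ip_sum_left ip_commute[of d y])
  have Ae: "ip d (A x) (e k) = \<omega> k * ip d x (e k)" if "k < n" for x k
    using eA[OF that] unfolding A_def gram_symmetric by (simp add: ip_right)
  have AV: "A x \<in> vecs d" for x by (simp add: A_def)
  have AB: "nrm_sq s (mv s d B x) = ip d (A x) x" for x
    by (simp add: A_def mtv_adjoint nrm_sq_def)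
  have NB: "nrm_sq s (mv s d B x) = (\<Sum>k<n. \<omega> k * (ip d x (e k))\<^sup>2)" if "x \<in> vecs d" for x
    unfolding AB by (subst parseval[OF AV]) (simp add: Ae power2_eq_square mult.assoc)
  have NA: "nrm_sq d (A x) = (\<Sum>k<n. \<omega> k * (\<omega> k * (ip d x (e k))\<^sup>2))" if "x \<in> vecs d" for x
    unfolding nrm_sq_def by (subst parseval[OF AV]) (simp add: Ae power2_eq_square mult_ac)
  have N: "nrm_sq d x = (\<Sum>k<n. (ip d x (e k))\<^sup>2)" if "x \<in> vecs d" for x
    unfolding nrm_sq_def by (subst parseval[OF that]) (simp add: power2_eq_square)
  have l0: "0 \<le> \<omega> k" if "k < n" for k
  proof -
    have "nrm_sq s (mv s d B (e k)) = \<omega> k"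
      unfolding AB eA[OF that] by (simp add: ip_left e1[OF that])
    then show ?thesis using nrm_sq_nonneg by metis
  qed
  \<comment> \<open>Together with \<open>sv_of\<close> this identifies the singular values with the
    numbers \<open>sqrt (\<omega> k)\<close>. There are finitely many, so \<open>Max\<close> and
    \<open>Min\<close> are attained.\<close>
  have sv_in: "sqrt (\<omega> k) \<in> singular_values s d B" if "k < n" for k
  proof -
    have "e k \<noteq> (\<lambda>_. 0)" using e1[OF that] by (auto simp: ip_def)
    then show ?thesis
      using ev[OF that] eA[OF that] l0[OF that] by (auto simp: singular_values_def A_def)
  qed
  have sv_of: "\<exists>k<n. \<sigma> = sqrt (\<omega> k)" if "\<sigma> \<in> singular_values s d B" for \<sigma>
  proof -
    obtain x where x: "x \<in> vecs d" "x \<noteq> (\<lambda>_. 0)" "A x = (\<lambda>i. \<sigma>\<^sup>2 * x i)" and s0: "\<sigma> \<ge> 0"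
      using \<open>\<sigma> \<in> _\<close> by (auto simp: singular_values_def A_def)
    have "\<exists>k<n. ip d x (e k) \<noteq> 0"
    proof (rule ccontr)
      assume "\<not> ?thesis"
      then have "nrm_sq d x = 0" using N[OF x(1)] by simp
      then show False using x nrm_sq_eq_0_iff by blast
    qed
    then obtain k where k: "k < n" "ip d x (e k) \<noteq> 0" by blast
    have "\<omega> k = \<sigma>\<^sup>2" using Ae[OF k(1), of x] k(2) unfolding x(3) by (simp add: ip_left)
    then show ?thesis using k s0 by (auto simp: real_sqrt_abs)
  qed
  have fin: "finite (singular_values s d B)"
    by (rule finite_subset[of _ "(\<lambda>k. sqrt (\<omega> k)) ` {..<n}"]) (use sv_of in auto)
  have max: "\<omega> k \<le> (sigma_max s d B)\<^sup>2" if "k < n" for k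
  proof -
    have "sqrt (\<omega> k) \<le> sigma_max s d B"
      unfolding sigma_max_def using fin sv_in[OF that] by simp
    then show ?thesis using l0[OF that] by (simp add: sqrt_le_D)
  qed
  \<comment> \<open>Without a positive eigenvalue \<open>B\<close> would annihilate every vector,
    also the unit vector that selects a column with a nonzero entry. Hence the set under
    \<open>Min\<close> is not empty.\<close>
  have "\<exists>k<n. \<omega> k > 0"
  proof (rule ccontr)
    assume "\<not> ?thesis"
    then have zero: "\<omega> k = 0" if "k < n" for k using l0[OF that] that by force
    obtain i j where ij: "i < s" "j < d" "B i j \<noteq> 0" using B by blast
    define x :: "nat \<Rightarrow> real" where "x = (\<lambda>l. if l = j then 1 else 0)"
    have "x \<in> vecs d" using ij by (auto simp: x_def vecs_def)
    then have "nrm_sq s (mv s d B x) = 0" using NB zero by simp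
    then have "mv s d B x = (\<lambda>_. 0)" by (simp add: nrm_sq_eq_0_iff)
    then have "mv s d B x i = 0" by (rule fun_cong)
    moreover have "mv s d B x i = (\<Sum>l<d. if l = j then B i l else 0)"
      using ij(1) by (simp add: mv_def x_def if_distrib cong: if_cong)
    ultimately show False using ij by (simp add: sum.delta)
  qed
  then obtain k0 where k0: "k0 < n" "\<omega> k0 > 0" by blast
  let ?P = "{\<sigma> \<in> singular_values s d B. \<sigma> > 0}"
  have P: "finite ?P" "?P \<noteq> {}" using fin sv_in[OF k0(1)] k0 by auto
  have smin: "sigma_min_pos s d B \<in> ?P" unfolding sigma_min_pos_def by (rule Min_in[OF P])
  then show "0 < sigma_min_pos s d B" by simp
  show "sigma_min_pos s d B \<le> sigma_max s d B"
    unfolding sigma_max_def using smin fin by simp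
  have min: "(sigma_min_pos s d B)\<^sup>2 \<le> \<omega> k" if "k < n" "\<omega> k \<noteq> 0" for k
  proof -
    have "sigma_min_pos s d B \<le> sqrt (\<omega> k)"
      unfolding sigma_min_pos_def using P sv_in[OF that(1)] l0[OF that(1)] that by (intro Min_le) auto
    then have "(sigma_min_pos s d B)\<^sup>2 \<le> (sqrt (\<omega> k))\<^sup>2"
      using smin by (intro power_mono) auto
    then show ?thesis using l0[OF that(1)] by simp
  qed
  {
    fix x assume x: "x \<in> vecs d"
    show "nrm_sq s (mv s d B x) \<le> (sigma_max s d B)\<^sup>2 * nrm_sq d x"
      unfolding NB[OF x] N[OF x] sum_distrib_left
      by (intro sum_mono mult_right_mono max) auto
    show "nrm_sq d (mtv s d B (mv s d B x)) \<le> (sigma_max s d B)\<^sup>2 * nrm_sq s (mv s d B x)"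
      unfolding NB[OF x] NA[OF x, unfolded A_def] sum_distrib_left
      by (intro sum_mono mult_right_mono max mult_nonneg_nonneg l0) auto
    show "(sigma_min_pos s d B)\<^sup>2 * nrm_sq s (mv s d B x) \<le> nrm_sq d (mtv s d B (mv s d B x))"
      unfolding NB[OF x] NA[OF x, unfolded A_def] sum_distrib_left
    proof (intro sum_mono)
      fix k assume "k \<in> {..<n}"
      then show "(sigma_min_pos s d B)\<^sup>2 * (\<omega> k * (ip d x (e k))\<^sup>2) \<le> \<omega> k * (\<omega> k * (ip d x (e k))\<^sup>2)"
        using min[of k] l0[of k] by (cases "\<omega> k = 0") (auto intro!: mult_right_mono)
    qed
  }
  fix q assume q: "q \<in> vecs d" and orth: "\<And>x. x \<in> vecs d \<Longrightarrow> mv s d B x = (\<lambda>_. 0) \<Longrightarrow> ip d q x = 0"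
  have q0: "ip d q (e k) = 0" if "k < n" "\<omega> k = 0" for k
  proof (rule orth[OF ev[OF that(1)]])
    have "nrm_sq s (mv s d B (e k)) = 0"
      unfolding AB eA[OF that(1)] by (simp add: that ip_def)
    then show "mv s d B (e k) = (\<lambda>_. 0)" by (simp add: nrm_sq_eq_0_iff)
  qed
  \<comment> \<open>The pseudoinverse applied to \<open>q\<close>. Where
    \<open>\<omega> k = 0\<close> the quotient is 0 by convention, which is right because
    \<open>q\<close> has no component there by \<open>q0\<close>.\<close>
  define w where "w = (\<lambda>j. \<Sum>k<n. (ip d q (e k) / \<omega> k) * e k j)"
  have w: "w \<in> vecs d" unfolding w_def by (intro vecs_sum ev) simp
  have "ip d w (e k) = ip d q (e k) / \<omega> k" if "k < n" for k
  proof -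
    have "ip d w (e k) = (\<Sum>l<n. if l = k then ip d q (e l) / \<omega> l else 0)"
      unfolding w_def ip_sum_left using E that by (intro sum.cong) (auto simp: eigenfamily_def)
    then show ?thesis using that by (simp add: sum.delta)
  qed
  then have "ip d (A w) (e k) = ip d q (e k)" if "k < n" for k
    using Ae[OF that, of w] that q0[of k] by (cases "\<omega> k = 0") auto
  then have "A w = q"
    using basis[of "A w"] basis[OF q] by (simp add: A_def)
  then show "\<exists>w\<in>vecs d. mtv s d B (mv s d B w) = q" using w by (auto simp: A_def)
qed

section \<open>Smooth convex functions\<close>

text \<open>Estimate \<open>G y\<close> at the point \<open>y = v - h / L\<close>, a gradient step
  from \<open>v\<close> for \<open>G\<close> minus its linear part at \<open>w\<close>: from above
  by smoothness at \<open>v\<close>, from below by convexity at \<open>w\<close>.\<close>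

lemma smooth_convex_gradient_gap:
  assumes L: "0 < L"
    and gV: "\<And>u. u \<in> vecs d \<Longrightarrow> gG u \<in> vecs d"
    and upper: "\<And>u v. u \<in> vecs d \<Longrightarrow> v \<in> vecs d \<Longrightarrow>
      G v \<le> G u + ip d (gG u) (\<lambda>i. v i - u i) + L / 2 * nrm_sq d (\<lambda>i. v i - u i)"
    and lower: "\<And>u v. u \<in> vecs d \<Longrightarrow> v \<in> vecs d \<Longrightarrow>
      G u + ip d (gG u) (\<lambda>i. v i - u i) \<le> G v"
    and v: "v \<in> vecs d" and w: "w \<in> vecs d"
  shows "nrm_sq d (\<lambda>i. gG v i - gG w i) \<le> 2 * L * (G v - G w - ip d (gG w) (\<lambda>i. v i - w i))"
proof -
  define h where "h = (\<lambda>i. gG v i - gG w i)"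
  define y where "y = (\<lambda>i. v i - (1 / L) * h i)"
  have h: "h \<in> vecs d" unfolding h_def by (intro vecs_closed gV v w)
  have y: "y \<in> vecs d" unfolding y_def by (intro vecs_closed v h)
  have yv: "(\<lambda>i. y i - v i) = (\<lambda>i. (-1 / L) * h i)" by (auto simp: y_def)
  have yw: "(\<lambda>i. y i - w i) = (\<lambda>i. (v i - w i) - (1 / L) * h i)" by (auto simp: y_def)
  have sq: "(-1 / L)\<^sup>2 = 1 / L * (1 / L)" by (simp add: power2_eq_square)
  have "G w + (ip d (gG w) (\<lambda>i. v i - w i) - 1 / L * ip d (gG w) h)
      \<le> G v - 1 / L * ip d (gG v) h + L / 2 * (1 / L * (1 / L) * nrm_sq d h)"
    using upper[OF v y] lower[OF w y] unfolding yv yw nrm_sq_scale ip_right sq by simp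
  moreover have "1 / L * ip d (gG v) h - 1 / L * ip d (gG w) h = 1 / L * nrm_sq d h"
    unfolding nrm_sq_def by (subst (3) h_def) (simp only: ip_left right_diff_distrib)
  moreover have "L / 2 * (1 / L * (1 / L) * nrm_sq d h) = 1 / L * nrm_sq d h / 2"
    using L by simp
  ultimately have "1 / L * nrm_sq d h / 2 \<le> G v - G w - ip d (gG w) (\<lambda>i. v i - w i)" by linarith
  then show ?thesis using L unfolding h_def by (simp add: field_simps)
qed

text \<open>A step along a kernel direction stays feasible, so the quadratic upper bound of
  \<open>G\<close> along it is nowhere below its value at \<open>us\<close>. This orthogonality
  yields the multiplier.\<close>

lemma constrained_minimiser_gradient:
  assumes gV: "\<And>u. u \<in> vecs d \<Longrightarrow> gG u \<in> vecs d"
    and upper: "\<And>u v. u \<in> vecs d \<Longrightarrow> v \<in> vecs d \<Longrightarrow>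
      G v \<le> G u + ip d (gG u) (\<lambda>i. v i - u i) + L / 2 * nrm_sq d (\<lambda>i. v i - u i)"
    and us: "us \<in> vecs d" and min: "\<And>u. u \<in> vecs d \<Longrightarrow> mv s d B u = mv s d B us \<Longrightarrow> G us \<le> G u"
    and x: "x \<in> vecs d" "mv s d B x = (\<lambda>_. 0)"
  shows "ip d (gG us) x = 0"
proof -
  have "0 \<le> 2 * t * (ip d (gG us) x) + t\<^sup>2 * (L * nrm_sq d x)" for t
  proof -
    define y where "y = (\<lambda>i. us i + t * x i)"
    have y: "y \<in> vecs d" unfolding y_def by (intro vecs_closed us x(1))
    have yu: "(\<lambda>i. y i - us i) = (\<lambda>i. t * x i)" by (simp add: y_def)
    have "mv s d B y = mv s d B us" unfolding y_def mv_linear x(2) by simp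
    from min[OF y this] upper[OF us y] show ?thesis
      unfolding yu ip_right nrm_sq_scale by (simp add: algebra_simps)
  qed
  then show ?thesis by (rule linear_coefficient_zero)
qed

section \<open>Convergence of the algorithm\<close>

text \<open>The hypothesis is the optimality condition of the implicit \<open>u\<close> update. It
  is multiplied by \<open>2 * (u' - us)\<close> and the quadratic products are expanded by the
  three-point identity.\<close>

lemma prox_step_identity:
  fixes \<eta> \<mu> :: real
  assumes "\<And>i. (u' i - u i) / \<eta> + \<mu> * (u' i - v i) + h i + q i = 0"
  shows "(1 / \<eta> + \<mu>) * nrm_sq d (\<lambda>i. u' i - us i) + 1 / \<eta> * nrm_sq d (\<lambda>i. u' i - u i)
      + \<mu> * nrm_sq d (\<lambda>i. u' i - v i) + 2 * ip d h (\<lambda>i. u' i - us i) + 2 * ip d q (\<lambda>i. u' i - us i)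
    = 1 / \<eta> * nrm_sq d (\<lambda>i. u i - us i) + \<mu> * nrm_sq d (\<lambda>i. v i - us i)"
proof -
  define a where "a = 1 / \<eta>"
  have q: "q i = - (a * (u' i - u i) + \<mu> * (u' i - v i) + h i)" for i
    using assms[of i] by (simp add: a_def)
  have pt: "(a + \<mu>) * ((u' i - us i) * (u' i - us i)) + a * ((u' i - u i) * (u' i - u i))
      + \<mu> * ((u' i - v i) * (u' i - v i)) + 2 * (h i * (u' i - us i)) + 2 * (q i * (u' i - us i))
    = a * ((u i - us i) * (u i - us i)) + \<mu> * ((v i - us i) * (v i - us i))" for i
    unfolding q by algebra
  show ?thesis
    unfolding nrm_sq_def ip_def a_def[symmetric] sum_distrib_left sum.distrib[symmetric]
    by (intro sum.cong refl pt)
qed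

lemma nrm_sq_add3_le:
  "nrm_sq d (\<lambda>i. x i + y i + z i) \<le> 3 * (nrm_sq d x + nrm_sq d y + nrm_sq d z)"
proof -
  have "nrm_sq d (\<lambda>i. x i + y i + z i) =
      nrm_sq d x + nrm_sq d y + nrm_sq d z + 2 * ip d x y + 2 * ip d x z + 2 * ip d y z"
    by (simp add: nrm_sq_add ip_left)
  moreover have "2 * ip d x y \<le> nrm_sq d x + nrm_sq d y" "2 * ip d x z \<le> nrm_sq d x + nrm_sq d z"
    "2 * ip d y z \<le> nrm_sq d y + nrm_sq d z"
    using ip_le_nrm_sq[of d x y] ip_le_nrm_sq[of d x z] ip_le_nrm_sq[of d y z] by simp_all
  ultimately show ?thesis unfolding distrib_left by linarith
qed

text \<open>Only the two quadratic bounds on \<open>G\<close> are assumed, so the locale also fits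
  the regularised objective with its shifted constants. The vector \<open>ws\<close> represents the
  optimal multiplier.\<close>

locale apapc_problem =
  fixes d s :: nat and B :: "nat \<Rightarrow> nat \<Rightarrow> real" and b :: "nat \<Rightarrow> real"
    and G :: "(nat \<Rightarrow> real) \<Rightarrow> real" and gG :: "(nat \<Rightarrow> real) \<Rightarrow> nat \<Rightarrow> real"
    and L \<mu> :: real and us ws :: "nat \<Rightarrow> real"
  assumes B_nonzero: "\<exists>i<s. \<exists>j<d. B i j \<noteq> 0"
    and mu_pos: "0 < \<mu>" and mu_less: "\<mu> < L"
    and gV: "\<And>u. u \<in> vecs d \<Longrightarrow> gG u \<in> vecs d"
    and upper: "\<And>u v. u \<in> vecs d \<Longrightarrow> v \<in> vecs d \<Longrightarrow>
      G v \<le> G u + ip d (gG u) (\<lambda>i. v i - u i) + L / 2 * nrm_sq d (\<lambda>i. v i - u i)"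
    and strong: "\<And>u v. u \<in> vecs d \<Longrightarrow> v \<in> vecs d \<Longrightarrow>
      G u + ip d (gG u) (\<lambda>i. v i - u i) + \<mu> / 2 * nrm_sq d (\<lambda>i. v i - u i) \<le> G v"
    and us: "us \<in> vecs d" "mv s d B us = b"
    and ws: "ws \<in> vecs d" "mtv s d B (mv s d B ws) = (\<lambda>i. - gG us i)"
begin

section \<open>Parameters and Lyapunov function\<close>

definition "A x = mtv s d B (mv s d B x)"
definition "smax = sigma_max s d B"
definition "\<kappa> = kappa_B s d B"
definition "\<tau> = sqrt (\<mu> / L) / 2"
text \<open>Half of \<open>1 / \<eta>\<close> absorbs the smoothness error of the extrapolated
  point, the other half pays for the dual decay. With this \<tau> it also gives
  \<open>\<eta> * \<mu> = \<tau>\<close>.\<close>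

definition "\<eta> = 1 / (4 * \<tau> * L)"
text \<open>This step size gives \<open>A_norm_le\<close>, which makes \<Psi> nonnegative and fixes
  the sign of the remainder in \<open>dual_step\<close>.\<close>

definition "\<theta> = 1 / (\<eta> * smax\<^sup>2)"
text \<open>Chosen so that \<open>\<rho> * (\<eta> * \<kappa> * (12 * L)) = 1\<close>, where
  \<open>\<eta> * \<kappa>\<close> comes from \<open>Psi_le\<close> and \<open>12 * L\<close> from
  \<open>residual_bound\<close>.\<close>

definition "\<rho> = \<tau> / (3 * \<kappa>)"

definition "H v = G v - G us - ip d (gG us) (\<lambda>i. v i - us i)"
text \<open>In terms of the dual error \<open>A (w - ws)\<close> the first part is the quadratic
  form of the pseudoinverse of \<open>A\<close>, expressed through \<open>w\<close> without
  inverting. The subtracted part accounts for the half step still using the old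
  \<open>z\<close>.\<close>

definition "\<Psi> w = 1 / \<theta> * nrm_sq s (mv s d B (\<lambda>i. w i - ws i))
  - \<eta> / (1 + \<eta> * \<mu>) * nrm_sq d (A (\<lambda>i. w i - ws i))"
text \<open>The extra \<open>\<rho> * \<Psi> w\<close> is what a step gains from its leftover terms.
  The weight of \<open>H uf\<close> is twice the reciprocal of the extrapolation factor
  \<open>2 * \<tau> / (2 - \<tau>)\<close>.\<close>

definition "\<Phi> u uf w = (1 / \<eta> + \<mu>) * nrm_sq d (\<lambda>i. u i - us i) + (1 + \<rho>) * \<Psi> w
  + (2 - \<tau>) / \<tau> * H uf"

lemma L_pos: "0 < L" using mu_pos mu_less by simp

lemma smax_pos: "0 < smax"
  using singular_value_bounds(1,2)[OF B_nonzero] by (simp add: smax_def)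

lemma kappa_ge_1: "1 \<le> \<kappa>"
  using singular_value_bounds(1,2)[OF B_nonzero]
  by (simp add: \<kappa>_def kappa_B_def power_mono)

lemma tau_bounds: "0 < \<tau>" "\<tau> < 1/2"
  using mu_pos mu_less by (auto simp: \<tau>_def)

lemma tau_sq: "4 * \<tau>\<^sup>2 * L = \<mu>"
  using mu_pos mu_less by (simp add: \<tau>_def power_divide)

lemma eta_pos: "0 < \<eta>" using tau_bounds L_pos by (simp add: \<eta>_def)

lemma inverse_eta: "1 / \<eta> = 4 * \<tau> * L" using tau_bounds L_pos by (simp add: \<eta>_def)

lemma eta_mu: "\<eta> * \<mu> = \<tau>"
proof -
  have "\<eta> * (4 * \<tau>\<^sup>2 * L) = \<tau>"
    using tau_bounds L_pos by (simp add: \<eta>_def power2_eq_square)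
  then show ?thesis by (simp only: tau_sq)
qed

lemma theta_pos: "0 < \<theta>" using eta_pos smax_pos by (simp add: \<theta>_def)

lemma inverse_theta: "1 / \<theta> = \<eta> * smax\<^sup>2" by (simp add: \<theta>_def)

lemma rho_bounds: "0 < \<rho>" "3 * \<rho> \<le> \<tau>"
  using kappa_ge_1 tau_bounds by (auto simp: \<rho>_def field_simps)

lemma lower:
  assumes "u \<in> vecs d" "v \<in> vecs d"
  shows "G u + ip d (gG u) (\<lambda>i. v i - u i) \<le> G v"
proof -
  have "0 \<le> \<mu> / 2 * nrm_sq d (\<lambda>i. v i - u i)" using mu_pos by simp
  then show ?thesis using strong[OF assms] by linarith
qed

lemma H_nonneg: "v \<in> vecs d \<Longrightarrow> 0 \<le> H v"
  using lower[OF us(1)] by (simp add: H_def algebra_simps)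

lemma H_diff: "H v - H u = G v - G u - ip d (gG us) (\<lambda>i. v i - u i)"
  by (simp add: H_def ip_right)

lemma gradient_gap: "v \<in> vecs d \<Longrightarrow> nrm_sq d (\<lambda>i. gG v i - gG us i) \<le> 2 * L * H v"
  unfolding H_def by (rule smooth_convex_gradient_gap[OF L_pos gV upper lower _ us(1)])

lemma A_norm_le:
  "x \<in> vecs d \<Longrightarrow> \<eta> * nrm_sq d (A x) \<le> 1 / \<theta> * nrm_sq s (mv s d B x)"
  using singular_value_bounds(4)[OF B_nonzero, of x] eta_pos
  by (simp add: A_def inverse_theta smax_def mult_left_mono mult.assoc)

text \<open>The smallest positive singular value reverses \<open>A_norm_le\<close> at the price of
  the factor \<kappa>.\<close>

lemma B_norm_le:
  assumes "x \<in> vecs d"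
  shows "1 / \<theta> * nrm_sq s (mv s d B x) \<le> \<eta> * \<kappa> * nrm_sq d (A x)"
proof -
  let ?m = "(sigma_min_pos s d B)\<^sup>2"
  have m: "0 < ?m" using singular_value_bounds(1)[OF B_nonzero] by simp
  have "\<kappa> * (?m * nrm_sq s (mv s d B x)) \<le> \<kappa> * nrm_sq d (A x)"
    using singular_value_bounds(5)[OF B_nonzero assms] kappa_ge_1
    by (intro mult_left_mono) (auto simp: A_def)
  moreover have "\<kappa> * ?m = smax\<^sup>2" using m by (simp add: \<kappa>_def kappa_B_def smax_def)
  ultimately have "smax\<^sup>2 * nrm_sq s (mv s d B x) \<le> \<kappa> * nrm_sq d (A x)"
    by (metis mult.assoc)
  then have "\<eta> * (smax\<^sup>2 * nrm_sq s (mv s d B x)) \<le> \<eta> * (\<kappa> * nrm_sq d (A x))"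
    using eta_pos by (intro mult_left_mono) auto
  then show ?thesis by (simp add: inverse_theta mult.assoc)
qed

lemma eta'_le: "0 \<le> \<eta> / (1 + \<eta> * \<mu>)" "\<eta> / (1 + \<eta> * \<mu>) \<le> \<eta>"
  using eta_pos mu_pos by (auto simp: divide_le_eq)

lemma Psi_nonneg: "w \<in> vecs d \<Longrightarrow> 0 \<le> \<Psi> w"
proof -
  assume "w \<in> vecs d"
  then have x: "(\<lambda>i. w i - ws i) \<in> vecs d" using ws by blast
  have "\<eta> / (1 + \<eta> * \<mu>) * nrm_sq d (A (\<lambda>i. w i - ws i)) \<le> \<eta> * nrm_sq d (A (\<lambda>i. w i - ws i))"
    by (intro mult_right_mono eta'_le nrm_sq_nonneg)
  then show ?thesis using A_norm_le[OF x] unfolding \<Psi>_def by linarith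
qed

lemma Psi_le: "w \<in> vecs d \<Longrightarrow> \<Psi> w \<le> \<eta> * \<kappa> * nrm_sq d (A (\<lambda>i. w i - ws i))"
proof -
  assume "w \<in> vecs d"
  then have x: "(\<lambda>i. w i - ws i) \<in> vecs d" using ws by blast
  have "0 \<le> \<eta> / (1 + \<eta> * \<mu>) * nrm_sq d (A (\<lambda>i. w i - ws i))"
    by (intro mult_nonneg_nonneg eta'_le nrm_sq_nonneg)
  then show ?thesis using B_norm_le[OF x] unfolding \<Psi>_def by linarith
qed

section \<open>Estimates for a single step\<close>

lemma dual_step:
  assumes w: "w \<in> vecs d" "w' \<in> vecs d"
    and uh: "\<And>i. w' i = w i + \<theta> * (uh i - us i)"
    and u': "\<And>i. u' i = uh i - \<eta> / (1 + \<eta> * \<mu>) * (A w' i - A w i)"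
  shows "\<Psi> w' - \<Psi> w \<le> 2 * ip d (A (\<lambda>i. w' i - ws i)) (\<lambda>i. u' i - us i)"
proof -
  define m where "m = (\<lambda>i. w' i - ws i)"
  define n where "n = (\<lambda>i. w' i - w i)"
  define \<eta>' where "\<eta>' = \<eta> / (1 + \<eta> * \<mu>)"
  have n: "n \<in> vecs d" unfolding n_def by (intro vecs_closed w)
  have mn: "(\<lambda>i. w i - ws i) = (\<lambda>i. m i - n i)" by (simp add: m_def n_def)
  have Amn: "A (\<lambda>i. m i - n i) = (\<lambda>i. A m i - A n i)" by (simp add: A_def mv_linear mtv_linear)
  have An: "A w' i - A w i = A n i" for i by (simp add: n_def A_def mv_linear mtv_linear)
  \<comment> \<open>The primal error is expressed by the dual increment \<open>n\<close>. Its inner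
    product with \<open>A m\<close> polarises into the difference of \<Psi>, up to
    \<open>1 / \<theta> * |B n|^2 - \<eta>' * |A n|^2\<close>, which is nonnegative.\<close>
  have d: "(\<lambda>i. u' i - us i) = (\<lambda>i. 1 / \<theta> * n i - \<eta>' * A n i)"
    using theta_pos by (auto simp: u' An \<eta>'_def n_def uh)
  have "ip d (A m) n = ip s (mv s d B m) (mv s d B n)" by (simp add: A_def mtv_adjoint)
  then have "2 * ip d (A m) (\<lambda>i. u' i - us i) =
      1 / \<theta> * (2 * ip s (mv s d B m) (mv s d B n)) - \<eta>' * (2 * ip d (A m) (A n))"
    unfolding d ip_right by (simp only: algebra_simps)
  moreover have "\<Psi> w' = 1 / \<theta> * nrm_sq s (mv s d B m) - \<eta>' * nrm_sq d (A m)"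
    by (simp add: \<Psi>_def m_def \<eta>'_def)
  moreover have "\<Psi> w = 1 / \<theta> * (nrm_sq s (mv s d B m) - 2 * ip s (mv s d B m) (mv s d B n)
        + nrm_sq s (mv s d B n)) - \<eta>' * (nrm_sq d (A m) - 2 * ip d (A m) (A n) + nrm_sq d (A n))"
    unfolding \<Psi>_def mn Amn mv_linear nrm_sq_diff \<eta>'_def[symmetric] ..
  moreover have "\<eta>' * nrm_sq d (A n) \<le> \<eta> * nrm_sq d (A n)"
    unfolding \<eta>'_def by (intro mult_right_mono eta'_le nrm_sq_nonneg)
  moreover note A_norm_le[OF n]
  ultimately show ?thesis unfolding m_def[symmetric] by (simp only: algebra_simps)
qed

text \<open>The error \<open>2 * (u' - us)\<close> splits along \<open>ug - us\<close>,
  \<open>uf' - ug\<close> and \<open>ug - uf\<close>. Strong convexity, smoothness and convexity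
  handle these three directions in turn.\<close>

lemma primal_step:
  assumes V: "u \<in> vecs d" "uf \<in> vecs d" "u' \<in> vecs d"
    and ug: "\<And>i. ug i = \<tau> * u i + (1 - \<tau>) * uf i"
    and uf': "\<And>i. uf' i = ug i + 2 * \<tau> / (2 - \<tau>) * (u' i - u i)"
  shows "H ug + \<mu> * nrm_sq d (\<lambda>i. ug i - us i) + (2 - \<tau>) / \<tau> * H uf'
      - 2 * (1 - \<tau>) / \<tau> * H uf - 1 / (2 * \<eta>) * nrm_sq d (\<lambda>i. u' i - u i)
    \<le> 2 * ip d (\<lambda>i. gG ug i - gG us i) (\<lambda>i. u' i - us i)"
proof -
  define h where "h = (\<lambda>i. gG ug i - gG us i)"
  have ugV: "ug \<in> vecs d" using V by (auto simp: vecs_def ug)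
  have uf'V: "uf' \<in> vecs d" using V ugV by (auto simp: vecs_def uf')
  have t: "0 < \<tau>" "\<tau> < 1" using tau_bounds by auto
  define c where "c = (2 - \<tau>) / \<tau>"
  define c' where "c' = 2 * (1 - \<tau>) / \<tau>"
  have c: "0 < c" "0 < c'" using t by (auto simp: c_def c'_def)
  \<comment> \<open>Because of this relation the multiples 2, \<open>- c\<close> and
    \<open>c'\<close> of \<open>H ug\<close> add up to exactly one copy, which survives for the dual
    decay.\<close>
  have cc: "c' = c - 1" using t by (simp add: c_def c'_def field_simps)
  have d: "2 * (u' i - us i) = 2 * (ug i - us i) + c * (uf' i - ug i) + c' * (ug i - uf i)" for i
  proof -
    have "c * (uf' i - ug i) = 2 * (u' i - u i)" using t by (simp add: uf' c_def field_simps)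
    moreover have "c' * (ug i - uf i) = 2 * (u i - ug i)"
      using t by (simp add: ug c'_def field_simps)
    ultimately show ?thesis by simp
  qed
  have "2 * ip d h (\<lambda>i. u' i - us i) = ip d h (\<lambda>i. 2 * (u' i - us i))"
    by (simp only: ip_right)
  also have "\<dots> = 2 * ip d h (\<lambda>i. ug i - us i) + c * ip d h (\<lambda>i. uf' i - ug i)
      + c' * ip d h (\<lambda>i. ug i - uf i)"
    unfolding d by (simp add: ip_right)
  finally have e: "2 * ip d h (\<lambda>i. u' i - us i) = \<dots>" .
  have flip: "nrm_sq d (\<lambda>i. us i - ug i) = nrm_sq d (\<lambda>i. ug i - us i)"
    by (simp add: nrm_sq_diff ip_commute)
  have a1: "2 * H ug + \<mu> * nrm_sq d (\<lambda>i. ug i - us i) \<le> 2 * ip d h (\<lambda>i. ug i - us i)"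
    using strong[OF ugV us(1)] unfolding flip by (simp add: H_def h_def ip_left ip_right)
  have a2: "H uf' - H ug - L / 2 * nrm_sq d (\<lambda>i. uf' i - ug i) \<le> ip d h (\<lambda>i. uf' i - ug i)"
    using upper[OF ugV uf'V] unfolding H_diff h_def ip_left by simp
  have a3: "H ug - H uf \<le> ip d h (\<lambda>i. ug i - uf i)"
    using lower[OF ugV V(2)] unfolding H_def h_def by (simp add: ip_left ip_right)
  have ufug: "(\<lambda>i. uf' i - ug i) = (\<lambda>i. 2 / c * (1 / \<tau> * \<tau>) * (u' i - u i))"
    using t by (auto simp: uf' c_def)
  have "c * (L / 2 * nrm_sq d (\<lambda>i. uf' i - ug i)) = 2 * L / c * nrm_sq d (\<lambda>i. u' i - u i)"
    unfolding ufug nrm_sq_scale using t c by (simp add: power2_eq_square)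
  also have "\<dots> \<le> 1 / (2 * \<eta>) * nrm_sq d (\<lambda>i. u' i - u i)"
  proof (intro mult_right_mono nrm_sq_nonneg)
    \<comment> \<open>Since \<open>1 / c = \<tau> / (2 - \<tau>)\<close> is at most \<tau>, half of
      \<open>1 / \<eta>\<close> suffices here.\<close>
    have "1 / (2 * \<eta>) = 2 * \<tau> * L" using inverse_eta by simp
    moreover have "2 * L / c \<le> 2 * \<tau> * L"
      using t L_pos by (simp add: c_def field_simps)
    ultimately show "2 * L / c \<le> 1 / (2 * \<eta>)" by simp
  qed
  finally have a4: "c * (L / 2 * nrm_sq d (\<lambda>i. uf' i - ug i)) \<le> \<dots>" .
  have b2: "c * H uf' - c * H ug - c * (L / 2 * nrm_sq d (\<lambda>i. uf' i - ug i))
      \<le> c * ip d h (\<lambda>i. uf' i - ug i)"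
    using mult_left_mono[OF a2, of c] c by (simp only: right_diff_distrib)
  have b3: "c' * H ug - c' * H uf \<le> c' * ip d h (\<lambda>i. ug i - uf i)"
    using mult_left_mono[OF a3, of c'] c by (simp only: right_diff_distrib)
  have "c' * H ug = c * H ug - H ug" by (simp add: cc algebra_simps)
  then show ?thesis
    using e a1 a4 b2 b3 unfolding h_def c_def[symmetric] c'_def[symmetric] by linarith
qed

text \<open>The optimality condition writes the dual error \<open>q\<close> as a sum of three terms.
  Each squared norm is at most \<open>4 * L\<close> times its counterpart on the right, using
  \<open>1 / \<eta> \<le> 2 * L\<close>, \<open>\<mu> < L\<close> and \<open>gradient_gap\<close>;
  the square of a sum of three costs another 3.\<close>

lemma residual_bound:
  assumes "ug \<in> vecs d"
    and opt: "\<And>i. (u' i - u i) / \<eta> + \<mu> * (u' i - ug i) + (gG ug i - gG us i) + q i = 0"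
  shows "nrm_sq d q \<le> 12 * L *
    (H ug + 1 / (2 * \<eta>) * nrm_sq d (\<lambda>i. u' i - u i) + \<mu> * nrm_sq d (\<lambda>i. u' i - ug i))"
proof -
  have "q = (\<lambda>i. -1 * (1 / \<eta> * (u' i - u i) + \<mu> * (u' i - ug i) + (gG ug i - gG us i)))"
  proof
    show "q i = -1 * (1 / \<eta> * (u' i - u i) + \<mu> * (u' i - ug i) + (gG ug i - gG us i))" for i
      using opt[of i] by (simp add: eq_neg_iff_add_eq_0 add_ac)
  qed
  then have "nrm_sq d q = nrm_sq d (\<lambda>i. 1 / \<eta> * (u' i - u i) + \<mu> * (u' i - ug i) + (gG ug i - gG us i))"
    by (simp only: nrm_sq_scale) simp
  also have "\<dots> \<le> 3 * ((1 / \<eta>)\<^sup>2 * nrm_sq d (\<lambda>i. u' i - u i) + \<mu>\<^sup>2 * nrm_sq d (\<lambda>i. u' i - ug i)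
      + nrm_sq d (\<lambda>i. gG ug i - gG us i))"
    using nrm_sq_add3_le[of d "\<lambda>i. 1 / \<eta> * (u' i - u i)" "\<lambda>i. \<mu> * (u' i - ug i)"]
    by (simp only: nrm_sq_scale)
  also have "\<dots> \<le> 3 * (4 * L * (1 / (2 * \<eta>) * nrm_sq d (\<lambda>i. u' i - u i))
      + 4 * L * (\<mu> * nrm_sq d (\<lambda>i. u' i - ug i)) + 4 * L * H ug)"
  proof (intro mult_left_mono add_mono)
    have "1 / \<eta> * (1 / \<eta>) \<le> 2 * L * (1 / \<eta>)"
      using tau_bounds L_pos eta_pos unfolding inverse_eta
      by (intro mult_right_mono) auto
    then have "(1 / \<eta>)\<^sup>2 * nrm_sq d (\<lambda>i. u' i - u i) \<le> 2 * L * (1 / \<eta>) * nrm_sq d (\<lambda>i. u' i - u i)"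
      unfolding power2_eq_square by (rule mult_right_mono) simp
    then show "(1 / \<eta>)\<^sup>2 * nrm_sq d (\<lambda>i. u' i - u i)
        \<le> 4 * L * (1 / (2 * \<eta>) * nrm_sq d (\<lambda>i. u' i - u i))" by simp
    have "\<mu> * (\<mu> * nrm_sq d (\<lambda>i. u' i - ug i)) \<le> 4 * L * (\<mu> * nrm_sq d (\<lambda>i. u' i - ug i))"
      using mu_pos mu_less by (intro mult_right_mono) auto
    then show "\<mu>\<^sup>2 * nrm_sq d (\<lambda>i. u' i - ug i) \<le> 4 * L * (\<mu> * nrm_sq d (\<lambda>i. u' i - ug i))"
      by (simp add: power2_eq_square mult.assoc)
    have "0 \<le> L * H ug" using L_pos H_nonneg[OF assms(1)] by simp
    then show "nrm_sq d (\<lambda>i. gG ug i - gG us i) \<le> 4 * L * H ug"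
      using gradient_gap[OF assms(1)] by linarith
  qed simp
  finally show ?thesis by (simp add: algebra_simps)
qed

lemma step_contraction:
  assumes V: "u \<in> vecs d" "uf \<in> vecs d" "w \<in> vecs d"
    and step: "apapc_step s d B b gG \<eta> \<theta> \<mu> \<tau> (u, uf, A w) = (u', uf', z')"
  shows "\<exists>w'\<in>vecs d. z' = A w' \<and> u' \<in> vecs d \<and> uf' \<in> vecs d \<and> (1 + \<rho>) * \<Phi> u' uf' w' \<le> \<Phi> u uf w"
proof -
  define ug where "ug = (\<lambda>i. \<tau> * u i + (1 - \<tau>) * uf i)"
  define uh where "uh = (\<lambda>i. (u i - \<eta> * (gG ug i - \<mu> * ug i + A w i)) / (1 + \<eta> * \<mu>))"
  \<comment> \<open>The unknown \<open>us\<close> may appear here: as \<open>B us = b\<close>,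
    applying \<open>A\<close> to this increment gives the dual update that the algorithm
    computes.\<close>
  define w' where "w' = (\<lambda>i. w i + \<theta> * (uh i - us i))"
  have ugV: "ug \<in> vecs d" unfolding ug_def by (intro vecs_closed V)
  have gV': "gG ug \<in> vecs d" by (rule gV[OF ugV])
  have AV: "A x \<in> vecs d" for x by (simp add: A_def)
  have uhV: "uh \<in> vecs d" unfolding uh_def by (intro vecs_closed V ugV gV' AV)
  have w'V: "w' \<in> vecs d" unfolding w'_def by (intro vecs_closed V uhV us)
  have "A w' = (\<lambda>i. A w i + \<theta> * mtv s d B (\<lambda>i. mv s d B uh i - b i) i)"
    unfolding A_def w'_def mv_linear mtv_linear us(2) ..
  note Aw' = this
  define v where "v = (\<lambda>i. (u i - \<eta> * (gG ug i - \<mu> * ug i + A w' i)) / (1 + \<eta> * \<mu>))"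
  have "(u', uf', z') = (v, (\<lambda>i. ug i + 2 * \<tau> / (2 - \<tau>) * (v i - u i)), A w')"
    unfolding step[symmetric] v_def Aw' uh_def apapc_step_def Let_def prod.case ug_def ..
  then have z': "z' = A w'"
    and u': "u' = (\<lambda>i. (u i - \<eta> * (gG ug i - \<mu> * ug i + A w' i)) / (1 + \<eta> * \<mu>))"
    and uf': "uf' = (\<lambda>i. ug i + 2 * \<tau> / (2 - \<tau>) * (u' i - u i))"
    unfolding v_def by simp_all
  have u'V: "u' \<in> vecs d" unfolding u' by (intro vecs_closed V ugV gV' AV)
  have uf'V: "uf' \<in> vecs d" unfolding uf' by (intro vecs_closed V ugV u'V)
  have em: "1 + \<eta> * \<mu> > 0" using eta_pos mu_pos by (simp add: add_pos_pos)
  define q where "q = A (\<lambda>i. w' i - ws i)"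
  have q: "q i = A w' i + gG us i" for i
    using ws(2) by (simp add: q_def A_def mv_linear mtv_linear)
  have opt: "(u' i - u i) / \<eta> + \<mu> * (u' i - ug i) + (gG ug i - gG us i) + q i = 0" for i
  proof -
    have "(1 + \<eta> * \<mu>) * u' i = u i - \<eta> * (gG ug i - \<mu> * ug i + A w' i)"
      using em by (simp add: u')
    then have "(u' i - u i) + \<eta> * (\<mu> * (u' i - ug i) + (gG ug i - gG us i) + q i) = 0"
      by (simp add: q algebra_simps)
    then have "((u' i - u i) + \<eta> * (\<mu> * (u' i - ug i) + (gG ug i - gG us i) + q i)) / \<eta> = 0"
      by simp
    then show ?thesis using eta_pos by (simp add: add_divide_distrib)
  qed
  have dual: "\<Psi> w' - \<Psi> w \<le> 2 * ip d q (\<lambda>i. u' i - us i)"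
    unfolding q_def
  proof (rule dual_step[OF V(3) w'V])
    show "u' i = uh i - \<eta> / (1 + \<eta> * \<mu>) * (A w' i - A w i)" for i
      unfolding u' uh_def
      by (simp add: diff_divide_distrib add_divide_distrib distrib_left right_diff_distrib)
  qed (simp add: w'_def)
  have primal: "H ug + \<mu> * nrm_sq d (\<lambda>i. ug i - us i) + (2 - \<tau>) / \<tau> * H uf'
      - 2 * (1 - \<tau>) / \<tau> * H uf - 1 / (2 * \<eta>) * nrm_sq d (\<lambda>i. u' i - u i)
    \<le> 2 * ip d (\<lambda>i. gG ug i - gG us i) (\<lambda>i. u' i - us i)"
    by (rule primal_step[OF V(1,2) u'V]) (simp_all add: ug_def uf')
  define spare where "spare = H ug + 1 / (2 * \<eta>) * nrm_sq d (\<lambda>i. u' i - u i)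
    + \<mu> * nrm_sq d (\<lambda>i. u' i - ug i)"
  have half: "1 / \<eta> * nrm_sq d (\<lambda>i. u' i - u i) = 1 / (2 * \<eta>) * nrm_sq d (\<lambda>i. u' i - u i)
     + 1 / (2 * \<eta>) * nrm_sq d (\<lambda>i. u' i - u i)" by simp
  \<comment> \<open>Inserting the primal and dual estimates into the identity cancels the distance
    from \<open>ug\<close> to \<open>us\<close>; what is not consumed is collected in
    \<open>spare\<close>.\<close>
  have main: "(1 / \<eta> + \<mu>) * nrm_sq d (\<lambda>i. u' i - us i) + \<Psi> w' + (2 - \<tau>) / \<tau> * H uf' + spare
      \<le> 1 / \<eta> * nrm_sq d (\<lambda>i. u i - us i) + \<Psi> w + 2 * (1 - \<tau>) / \<tau> * H uf"
    using prox_step_identity[of u' u \<eta> \<mu> ug "\<lambda>i. gG ug i - gG us i" q d us, OF opt] dual primal half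
    unfolding spare_def by linarith
  have "\<rho> * \<Psi> w' \<le> spare"
  proof -
    have "\<Psi> w' \<le> \<eta> * \<kappa> * nrm_sq d q"
      unfolding q_def by (rule Psi_le[OF w'V])
    also have "\<dots> \<le> \<eta> * \<kappa> * (12 * L * spare)"
      unfolding spare_def using kappa_ge_1 eta_pos
      by (intro mult_left_mono residual_bound[OF ugV opt]) auto
    finally have "\<rho> * \<Psi> w' \<le> \<rho> * (\<eta> * \<kappa> * (12 * L * spare))"
      using rho_bounds by (intro mult_left_mono) auto
    also have "\<dots> = spare"
      using tau_bounds kappa_ge_1 L_pos by (simp add: \<rho>_def \<eta>_def)
    finally show ?thesis .
  qed
  with main have "\<Phi> u' uf' w' \<le> 1 / \<eta> * nrm_sq d (\<lambda>i. u i - us i) + \<Psi> w + 2 * (1 - \<tau>) / \<tau> * H uf"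
    unfolding \<Phi>_def by (simp only: distrib_right)
  then have "(1 + \<rho>) * \<Phi> u' uf' w' \<le>
      (1 + \<rho>) * (1 / \<eta> * nrm_sq d (\<lambda>i. u i - us i) + \<Psi> w + 2 * (1 - \<tau>) / \<tau> * H uf)"
    using rho_bounds by (intro mult_left_mono) auto
  also have "\<dots> = ((1 + \<rho>) * (1 / \<eta>)) * nrm_sq d (\<lambda>i. u i - us i) + (1 + \<rho>) * \<Psi> w
      + ((1 + \<rho>) * (2 * (1 - \<tau>) / \<tau>)) * H uf"
    by (simp only: algebra_simps)
  also have "\<dots> \<le> \<Phi> u uf w"
    unfolding \<Phi>_def
  proof (intro add_mono mult_right_mono nrm_sq_nonneg H_nonneg[OF V(2)] Psi_nonneg[OF V(3)]
      order_refl)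
    \<comment> \<open>The primal distance contracts thanks to the \<mu> in its weight; the weight of
      \<open>H uf\<close> contracts because \<open>2 * (1 - \<tau>)\<close> lies below
      \<open>2 - \<tau>\<close> by \<tau>.\<close>
    have "\<rho> \<le> \<eta> * \<mu>" using rho_bounds tau_bounds eta_mu by linarith
    then show "(1 + \<rho>) * (1 / \<eta>) \<le> 1 / \<eta> + \<mu>" using eta_pos by (simp add: field_simps)
    have "(1 + \<rho>) * (2 * (1 - \<tau>)) \<le> (1 + \<tau> / 3) * (2 * (1 - \<tau>))"
      using rho_bounds tau_bounds by (intro mult_right_mono) auto
    also have "\<dots> \<le> 2 - \<tau>"
    proof -
      have "(1 + \<tau> / 3) * (2 * (1 - \<tau>)) = 2 - \<tau> - \<tau> / 3 - 2 / 3 * \<tau>\<^sup>2"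
        by (simp add: algebra_simps power2_eq_square)
      then show ?thesis using tau_bounds zero_le_power2[of \<tau>] by linarith
    qed
    finally show "(1 + \<rho>) * (2 * (1 - \<tau>) / \<tau>) \<le> (2 - \<tau>) / \<tau>"
      using tau_bounds by (simp add: divide_right_mono)
  qed
  finally show ?thesis using w'V z' u'V uf'V by blast
qed

section \<open>Iterating the contraction and counting steps\<close>

lemma iterate_bound:
  assumes u0: "u0 \<in> vecs d"
  shows "\<exists>u uf. \<exists>w\<in>vecs d. apapc_iter s d B b gG \<eta> \<theta> \<mu> \<tau> u0 k = (u, uf, A w) \<and> u \<in> vecs d \<and> uf \<in> vecs d
    \<and> (1 + \<rho>) ^ k * \<Phi> u uf w \<le> \<Phi> u0 u0 (\<lambda>_. 0)"
proof (induction k)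
  case 0
  have "A (\<lambda>_. 0) = (\<lambda>_. 0)" by (simp add: A_def)
  then show ?case using u0 by (intro exI[of _ u0] bexI[of _ "\<lambda>_. 0"]) auto
next
  case (Suc k)
  then obtain u uf w where IH: "w \<in> vecs d" "apapc_iter s d B b gG \<eta> \<theta> \<mu> \<tau> u0 k = (u, uf, A w)"
    "u \<in> vecs d" "uf \<in> vecs d" "(1 + \<rho>) ^ k * \<Phi> u uf w \<le> \<Phi> u0 u0 (\<lambda>_. 0)" by blast
  obtain u' uf' z' where st: "apapc_step s d B b gG \<eta> \<theta> \<mu> \<tau> (u, uf, A w) = (u', uf', z')"
    by (metis prod_cases3)
  obtain w' where w': "w' \<in> vecs d" "z' = A w'" "u' \<in> vecs d" "uf' \<in> vecs d"
    and le: "(1 + \<rho>) * \<Phi> u' uf' w' \<le> \<Phi> u uf w"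
    using step_contraction[OF IH(3,4,1) st] by blast
  have "(1 + \<rho>) ^ k * ((1 + \<rho>) * \<Phi> u' uf' w') \<le> (1 + \<rho>) ^ k * \<Phi> u uf w"
    using rho_bounds by (intro mult_left_mono le) auto
  then have "(1 + \<rho>) ^ Suc k * \<Phi> u' uf' w' \<le> \<Phi> u0 u0 (\<lambda>_. 0)"
    using IH(5) by (simp add: mult_ac)
  moreover have "apapc_iter s d B b gG \<eta> \<theta> \<mu> \<tau> u0 (Suc k) = (u', uf', A w')"
    using IH(2) st w' by simp
  ultimately show ?case using w' by blast
qed

text \<open>Multiplication by \<eta> turns the weights into functions of \<mu>, L and \<kappa>
  through \<open>tau_sq\<close>. As the dual variable starts at 0, its initial error is the gradient
  at \<open>us\<close>.\<close>

lemma Phi_initial: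
  assumes u0: "u0 \<in> vecs d"
  shows "\<eta> * \<Phi> u0 u0 (\<lambda>_. 0) \<le> (2 + L / \<mu>) * nrm_sq d (\<lambda>i. u0 i - us i)
    + \<kappa> / (2 * \<mu> * L) * nrm_sq d (gG us)"
proof -
  let ?D = "nrm_sq d (\<lambda>i. u0 i - us i)"
  have "A (\<lambda>i. 0 - ws i) = (\<lambda>i. -1 * A ws i)"
    using mv_linear(3)[of s d B "-1" ws] mtv_linear(3)[of s d B "-1" "mv s d B ws"]
    by (simp add: A_def)
  then have "nrm_sq d (A (\<lambda>i. 0 - ws i)) = nrm_sq d (gG us)"
    using ws(2) by (simp add: A_def)
  then have Psi: "\<Psi> (\<lambda>_. 0) \<le> \<eta> * \<kappa> * nrm_sq d (gG us)"
    using Psi_le[of "\<lambda>_. 0"] by simp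
  have "(\<eta> * ((2 - \<tau>) / \<tau>)) * H u0 \<le> (2 / \<mu>) * (L / 2 * ?D)"
  proof (rule mult_mono)
    have "\<eta> * ((2 - \<tau>) / \<tau>) = (2 - \<tau>) / (4 * \<tau>\<^sup>2 * L)"
      by (simp add: \<eta>_def power2_eq_square)
    then show "\<eta> * ((2 - \<tau>) / \<tau>) \<le> 2 / \<mu>"
      unfolding tau_sq using tau_bounds mu_pos by (simp add: divide_right_mono)
    show "0 \<le> 2 / \<mu>" using mu_pos by simp
    show "H u0 \<le> L / 2 * ?D"
      using upper[OF us(1) u0] by (simp add: H_def)
  qed (rule H_nonneg[OF u0])
  moreover have "(\<eta> * (1 / \<eta> + \<mu>)) * ?D \<le> 2 * ?D"
    using eta_pos eta_mu tau_bounds by (intro mult_right_mono) (auto simp: distrib_left)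
  moreover have "(\<eta> * (1 + \<rho>)) * \<Psi> (\<lambda>_. 0) \<le> (\<eta> * 2) * (\<eta> * \<kappa> * nrm_sq d (gG us))"
    using eta_pos rho_bounds tau_bounds by (intro mult_mono Psi Psi_nonneg) auto
  moreover have "(\<eta> * 2) * (\<eta> * \<kappa> * nrm_sq d (gG us)) = \<kappa> / (2 * \<mu> * L) * nrm_sq d (gG us)"
  proof -
    have "(\<eta> * 2) * (\<eta> * \<kappa> * nrm_sq d (gG us)) = \<kappa> / (2 * (4 * \<tau>\<^sup>2 * L) * L) * nrm_sq d (gG us)"
      using tau_bounds L_pos by (simp add: \<eta>_def power2_eq_square)
    then show ?thesis by (simp only: tau_sq)
  qed
  moreover have "\<eta> * \<Phi> u0 u0 (\<lambda>_. 0) = (\<eta> * (1 / \<eta> + \<mu>)) * ?D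
      + (\<eta> * (1 + \<rho>)) * \<Psi> (\<lambda>_. 0) + (\<eta> * ((2 - \<tau>) / \<tau>)) * H u0"
  proof -
    have "e * (a * x + b * y + c * z) = (e * a) * x + (e * b) * y + (e * c) * z"
      for a b c e x y z :: real by (simp add: distrib_left mult.assoc)
    then show ?thesis unfolding \<Phi>_def .
  qed
  ultimately show ?thesis by (simp add: distrib_right)
qed

lemma apapc_error:
  assumes u0: "u0 \<in> vecs d"
  shows "(1 + \<rho>) ^ k * nrm_sq d (\<lambda>i. apapc s d B b gG \<eta> \<theta> \<mu> \<tau> u0 k i - us i)
    \<le> (2 + L / \<mu>) * nrm_sq d (\<lambda>i. u0 i - us i) + \<kappa> / (2 * \<mu> * L) * nrm_sq d (gG us)"
    and "apapc s d B b gG \<eta> \<theta> \<mu> \<tau> u0 k \<in> vecs d"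
proof -
  obtain u uf w where I: "w \<in> vecs d" "apapc_iter s d B b gG \<eta> \<theta> \<mu> \<tau> u0 k = (u, uf, A w)"
    "u \<in> vecs d" "uf \<in> vecs d" "(1 + \<rho>) ^ k * \<Phi> u uf w \<le> \<Phi> u0 u0 (\<lambda>_. 0)"
    using iterate_bound[OF u0] by blast
  have u: "apapc s d B b gG \<eta> \<theta> \<mu> \<tau> u0 k = u" using I(2) by (simp add: apapc_def)
  show "apapc s d B b gG \<eta> \<theta> \<mu> \<tau> u0 k \<in> vecs d" using u I by simp
  have "0 \<le> (1 + \<rho>) * \<Psi> w" "0 \<le> (2 - \<tau>) / \<tau> * H uf" "0 \<le> \<mu> * nrm_sq d (\<lambda>i. u i - us i)"
    using rho_bounds Psi_nonneg[OF I(1)] tau_bounds H_nonneg[OF I(4)] mu_pos by auto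
  then have "1 / \<eta> * nrm_sq d (\<lambda>i. u i - us i) \<le> \<Phi> u uf w"
    unfolding \<Phi>_def distrib_right by linarith
  then have "nrm_sq d (\<lambda>i. u i - us i) \<le> \<eta> * \<Phi> u uf w"
    using eta_pos by (simp add: field_simps)
  then have "(1 + \<rho>) ^ k * nrm_sq d (\<lambda>i. u i - us i) \<le> (1 + \<rho>) ^ k * (\<eta> * \<Phi> u uf w)"
    using rho_bounds by (intro mult_left_mono) auto
  also have "\<dots> = \<eta> * ((1 + \<rho>) ^ k * \<Phi> u uf w)" by simp
  also have "\<dots> \<le> \<eta> * \<Phi> u0 u0 (\<lambda>_. 0)" using I(5) eta_pos by (intro mult_left_mono) auto
  also note Phi_initial[OF u0]
  finally show "(1 + \<rho>) ^ k * nrm_sq d (\<lambda>i. apapc s d B b gG \<eta> \<theta> \<mu> \<tau> u0 k i - us i)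
    \<le> (2 + L / \<mu>) * nrm_sq d (\<lambda>i. u0 i - us i) + \<kappa> / (2 * \<mu> * L) * nrm_sq d (gG us)"
    unfolding u .
qed

end

text \<open>From \<open>ln (1 + \<rho>) \<ge> \<rho> / 2\<close>; the summand 1 pays for rounding
  up. The power \<open>p\<close> lets later arguments gain extra factors \<epsilon> that absorb
  constants.\<close>

lemma iteration_count:
  fixes \<rho> \<epsilon> :: real and p :: nat
  assumes "0 < \<rho>" "\<rho> \<le> 1 / 2" "0 < \<epsilon>" "\<epsilon> \<le> 1"
  obtains N :: nat where "real N \<le> 2 * real p * ln (1 / \<epsilon>) / \<rho> + 1" "1 \<le> (1 + \<rho>) ^ N * \<epsilon> ^ p"
proof
  define x where "x = 2 * real p * ln (1 / \<epsilon>) / \<rho>"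
  define N where "N = nat \<lceil>x\<rceil>"
  have ln0: "0 \<le> ln (1 / \<epsilon>)" using assms by simp
  then have x0: "0 \<le> x" using assms by (simp add: x_def)
  then show "real N \<le> 2 * real p * ln (1 / \<epsilon>) / \<rho> + 1"
    unfolding N_def x_def[symmetric] by linarith
  have Nx: "x \<le> real N" unfolding N_def by linarith
  have "\<rho> * \<rho> \<le> \<rho> * (1 / 2)" using assms by (intro mult_left_mono) auto
  then have "\<rho> / 2 \<le> ln (1 + \<rho>)"
    using ln_one_plus_pos_lower_bound[of \<rho>] assms unfolding power2_eq_square by linarith
  then have "x * (\<rho> / 2) \<le> real N * ln (1 + \<rho>)"
    using Nx x0 assms by (intro mult_mono) auto
  then have "real p * ln (1 / \<epsilon>) \<le> real N * ln (1 + \<rho>)"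
    using assms by (simp add: x_def)
  then have "ln ((1 / \<epsilon>) ^ p) \<le> ln ((1 + \<rho>) ^ N)"
    using assms by (simp add: ln_realpow)
  then have "(1 / \<epsilon>) ^ p \<le> (1 + \<rho>) ^ N"
    using assms by (subst (asm) ln_le_cancel_iff) auto
  then show "1 \<le> (1 + \<rho>) ^ N * \<epsilon> ^ p"
    using assms by (simp add: power_divide divide_le_eq)
qed

context apapc_problem
begin

text \<open>The bound on \<epsilon> makes \<open>ln (1 / \<epsilon>)\<close> at least 1, so the
  rounding summand is absorbed into the product. The 12 is 2 times the 6 in
  \<open>1 / \<rho> = 6 * \<kappa> * sqrt (L / \<mu>)\<close>.\<close>

lemma apapc_rate:
  assumes u0: "u0 \<in> vecs d" and \<epsilon>: "0 < \<epsilon>" "\<epsilon> \<le> exp (-1)"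
  obtains N where "real N \<le> (12 * real p + 1) * \<kappa> * sqrt (L / \<mu>) * ln (1 / \<epsilon>)"
    "apapc s d B b gG \<eta> \<theta> \<mu> \<tau> u0 N \<in> vecs d"
    "nrm_sq d (\<lambda>i. apapc s d B b gG \<eta> \<theta> \<mu> \<tau> u0 N i - us i) \<le>
      ((2 + L / \<mu>) * nrm_sq d (\<lambda>i. u0 i - us i) + \<kappa> / (2 * \<mu> * L) * nrm_sq d (gG us)) * \<epsilon> ^ p"
proof -
  let ?K = "(2 + L / \<mu>) * nrm_sq d (\<lambda>i. u0 i - us i) + \<kappa> / (2 * \<mu> * L) * nrm_sq d (gG us)"
  have "exp (-1) \<le> (1::real)" by simp
  then have \<epsilon>1: "\<epsilon> \<le> 1" using \<epsilon> by linarith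
  obtain N where N: "real N \<le> 2 * real p * ln (1 / \<epsilon>) / \<rho> + 1" "1 \<le> (1 + \<rho>) ^ N * \<epsilon> ^ p"
    using iteration_count[of \<rho> \<epsilon> p] rho_bounds tau_bounds \<epsilon> \<epsilon>1 by auto
  let ?e = "nrm_sq d (\<lambda>i. apapc s d B b gG \<eta> \<theta> \<mu> \<tau> u0 N i - us i)"
  have "1 * ?e \<le> ((1 + \<rho>) ^ N * \<epsilon> ^ p) * ?e" by (intro mult_right_mono N) simp
  also have "\<dots> = \<epsilon> ^ p * ((1 + \<rho>) ^ N * ?e)" by simp
  also have "\<dots> \<le> \<epsilon> ^ p * ?K"
    using \<epsilon> by (intro mult_left_mono apapc_error[OF u0]) auto
  finally have e: "?e \<le> ?K * \<epsilon> ^ p" by (simp add: mult.commute)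
  have "ln \<epsilon> \<le> -1" using \<epsilon> ln_mono[of \<epsilon> "exp (-1)"] by simp
  then have l1: "1 \<le> ln (1 / \<epsilon>)" using \<epsilon> by (simp add: ln_div)
  have s1: "1 \<le> sqrt (L / \<mu>)" using mu_pos mu_less by simp
  have rho: "1 / \<rho> = 6 * \<kappa> * sqrt (L / \<mu>)"
    using mu_pos L_pos kappa_ge_1 by (simp add: \<rho>_def \<tau>_def real_sqrt_divide)
  have "1 \<le> \<kappa> * sqrt (L / \<mu>)" using mult_mono[OF kappa_ge_1 s1] kappa_ge_1 by simp
  then have "1 \<le> \<kappa> * sqrt (L / \<mu>) * ln (1 / \<epsilon>)" using mult_mono[OF _ l1, of 1 "\<kappa> * sqrt (L / \<mu>)"] by simp
  moreover have "2 * real p * ln (1 / \<epsilon>) / \<rho> = 2 * real p * ln (1 / \<epsilon>) * (1 / \<rho>)" by simp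
  ultimately have "real N \<le> 2 * real p * ln (1 / \<epsilon>) * (6 * \<kappa> * sqrt (L / \<mu>)) + \<kappa> * sqrt (L / \<mu>) * ln (1 / \<epsilon>)"
    using N(1) unfolding rho by linarith
  also have "\<dots> = (12 * real p + 1) * \<kappa> * sqrt (L / \<mu>) * ln (1 / \<epsilon>)"
    by (simp only: algebra_simps)
  finally show ?thesis using that e apapc_error(2)[OF u0] by blast
qed

end

text \<open>Constructs the multiplier that the locale assumes: the negative gradient at the
  minimiser is orthogonal to the kernel of \<open>B\<close>, hence in the range of the Gram
  matrix.\<close>

lemma apapc_converges:
  fixes B :: "nat \<Rightarrow> nat \<Rightarrow> real" and L \<mu> :: real
  assumes B: "\<exists>i<s. \<exists>j<d. B i j \<noteq> 0"
    and mu: "0 < \<mu>" "\<mu> < L"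
    and gV: "\<And>u. u \<in> vecs d \<Longrightarrow> gG u \<in> vecs d"
    and upper: "\<And>u v. u \<in> vecs d \<Longrightarrow> v \<in> vecs d \<Longrightarrow>
      G v \<le> G u + ip d (gG u) (\<lambda>i. v i - u i) + L / 2 * nrm_sq d (\<lambda>i. v i - u i)"
    and strong: "\<And>u v. u \<in> vecs d \<Longrightarrow> v \<in> vecs d \<Longrightarrow>
      G u + ip d (gG u) (\<lambda>i. v i - u i) + \<mu> / 2 * nrm_sq d (\<lambda>i. v i - u i) \<le> G v"
    and us: "us \<in> vecs d" "mv s d B us = b"
    and min: "\<And>u. u \<in> vecs d \<Longrightarrow> mv s d B u = b \<Longrightarrow> G us \<le> G u"
    and u0: "u0 \<in> vecs d" and \<epsilon>: "0 < \<epsilon>" "\<epsilon> \<le> exp (-1)"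
  obtains \<eta> \<theta> \<alpha> \<tau> N where "\<eta> > 0" "\<theta> > 0" "\<alpha> > 0" "0 < \<tau>" "\<tau> < 1"
    "real N \<le> (12 * real p + 1) * kappa_B s d B * sqrt (L / \<mu>) * ln (1 / \<epsilon>)"
    "apapc s d B b gG \<eta> \<theta> \<alpha> \<tau> u0 N \<in> vecs d"
    "nrm_sq d (\<lambda>i. apapc s d B b gG \<eta> \<theta> \<alpha> \<tau> u0 N i - us i) \<le>
      ((2 + L / \<mu>) * nrm_sq d (\<lambda>i. u0 i - us i) + kappa_B s d B / (2 * \<mu> * L) * nrm_sq d (gG us)) * \<epsilon> ^ p"
proof -
  have q: "(\<lambda>i. - gG us i) \<in> vecs d" using gV[OF us(1)] by (simp add: vecs_def)
  have "ip d (\<lambda>i. - gG us i) x = 0" if "x \<in> vecs d" "mv s d B x = (\<lambda>_. 0)" for x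
  proof -
    have "ip d (gG us) x = 0"
      by (rule constrained_minimiser_gradient[OF gV upper us(1) _ that]) (use min us in auto)
    then show ?thesis by (simp add: ip_def sum_negf)
  qed
  then obtain ws where ws: "ws \<in> vecs d" "mtv s d B (mv s d B ws) = (\<lambda>i. - gG us i)"
    using singular_value_bounds(6)[OF B q] by blast
  interpret apapc_problem d s B b G gG L \<mu> us ws
    by unfold_locales (fact B mu gV upper strong us ws)+
  obtain N where "real N \<le> (12 * real p + 1) * \<kappa> * sqrt (L / \<mu>) * ln (1 / \<epsilon>)"
    "apapc s d B b gG \<eta> \<theta> \<mu> \<tau> u0 N \<in> vecs d"
    "nrm_sq d (\<lambda>i. apapc s d B b gG \<eta> \<theta> \<mu> \<tau> u0 N i - us i) \<le>
      ((2 + L / \<mu>) * nrm_sq d (\<lambda>i. u0 i - us i) + \<kappa> / (2 * \<mu> * L) * nrm_sq d (gG us)) * \<epsilon> ^ p"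
    using apapc_rate[OF u0 \<epsilon>] .
  then show ?thesis
    using that[of \<eta> \<theta> \<mu> \<tau> N] eta_pos theta_pos mu tau_bounds unfolding \<kappa>_def by auto
qed

section \<open>The regularised problem\<close>

text \<open>Near \<open>u\<close> the function lies between an affine and a quadratic function that
  both take the value \<open>G u\<close> at \<open>u\<close>.\<close>

lemma smooth_convex_continuous:
  assumes upper: "\<And>u v. u \<in> vecs d \<Longrightarrow> v \<in> vecs d \<Longrightarrow>
      G v \<le> G u + ip d (gG u) (\<lambda>i. v i - u i) + L / 2 * nrm_sq d (\<lambda>i. v i - u i)"
    and lower: "\<And>u v. u \<in> vecs d \<Longrightarrow> v \<in> vecs d \<Longrightarrow> G u + ip d (gG u) (\<lambda>i. v i - u i) \<le> G v"
  shows "continuous_on (vecs d) G"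
  unfolding continuous_on_def
proof
  fix u assume u: "u \<in> vecs d"
  let ?l = "\<lambda>v. G u + ip d (gG u) (\<lambda>i. v i - u i)"
  let ?h = "\<lambda>v. ?l v + L / 2 * nrm_sq d (\<lambda>i. v i - u i)"
  have c: "continuous_on (vecs d) ?l" "continuous_on (vecs d) ?h"
    unfolding nrm_sq_def by (intro continuous_intros)+
  have e: "?l u = G u" "?h u = G u" by (simp_all add: nrm_sq_def ip_def)
  have l: "(?l \<longlongrightarrow> G u) (at u within vecs d)"
    using bspec[OF c(1)[unfolded continuous_on_def] u] by (simp only: e)
  have h: "(?h \<longlongrightarrow> G u) (at u within vecs d)"
    using bspec[OF c(2)[unfolded continuous_on_def] u] by (simp only: e(2))
  have ev: "eventually (\<lambda>v. v \<in> vecs d) (at u within vecs d)"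
    by (simp add: eventually_at_filter)
  show "(G \<longlongrightarrow> G u) (at u within vecs d)"
    by (rule tendsto_sandwich[OF eventually_mono[OF ev lower[OF u]] eventually_mono[OF ev upper[OF u]] l h])
qed

lemma nrm_sq_shift: "nrm_sq d (\<lambda>i. v i - a i) = nrm_sq d (\<lambda>i. u i - a i)
    + 2 * ip d (\<lambda>i. u i - a i) (\<lambda>i. v i - u i) + nrm_sq d (\<lambda>i. v i - u i)"
  using nrm_sq_add[of d "\<lambda>i. u i - a i" "\<lambda>i. v i - u i"] by simp

text \<open>Outside the ball of radius R around u0 the regularised objective is at least its value at
  us, so it suffices to minimise over a compact set.\<close>

lemma regularised_minimiser:
  assumes cont: "continuous_on (vecs d) G"
    and us: "us \<in> vecs d" "mv s d B us = b"
    and min: "\<And>u. u \<in> vecs d \<Longrightarrow> mv s d B u = b \<Longrightarrow> G us \<le> G u"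
    and u0: "u0 \<in> vecs d" and R: "nrm_sq d (\<lambda>i. u0 i - us i) \<le> R\<^sup>2" and \<nu>: "0 \<le> \<nu>"
  obtains v where "v \<in> vecs d" "mv s d B v = b" "nrm_sq d (\<lambda>i. v i - u0 i) \<le> R\<^sup>2"
    "\<And>u. u \<in> vecs d \<Longrightarrow> mv s d B u = b \<Longrightarrow>
      G v + \<nu> / 2 * nrm_sq d (\<lambda>i. v i - u0 i) \<le> G u + \<nu> / 2 * nrm_sq d (\<lambda>i. u i - u0 i)"
proof -
  let ?F = "\<lambda>u. G u + \<nu> / 2 * nrm_sq d (\<lambda>i. u i - u0 i)"
  define S where "S = vecs d \<inter> {u. nrm_sq d (\<lambda>i. u i - u0 i) \<le> R\<^sup>2} \<inter> (\<Inter>i. {u. mv s d B u i = b i})"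
  have "closed S"
    unfolding S_def nrm_sq_def
    by (intro closed_Int closed_vecs closed_INT closed_Collect_le closed_Collect_eq ballI
        continuous_intros)
  moreover have "nrm_sq d x \<le> 2 * R\<^sup>2 + 2 * nrm_sq d u0" if "x \<in> S" for x
    using nrm_sq_add_le[of d "\<lambda>i. x i - u0 i" u0] that by (simp add: S_def)
  ultimately have "compact S" by (intro compact_bounded_vecs[of S d]) (auto simp: S_def)
  have R': "nrm_sq d (\<lambda>i. us i - u0 i) \<le> R\<^sup>2"
    using R by (simp add: nrm_sq_diff ip_commute)
  then have usS: "us \<in> S" using us by (auto simp: S_def)
  have "continuous_on S ?F"
    unfolding nrm_sq_def
    by (intro continuous_intros continuous_on_subset[OF cont]) (auto simp: S_def)
  then obtain v where v: "v \<in> S" "\<And>u. u \<in> S \<Longrightarrow> ?F v \<le> ?F u"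
    using continuous_attains_inf[OF \<open>compact S\<close>, of ?F] usS by blast
  have "?F v \<le> ?F u" if u: "u \<in> vecs d" "mv s d B u = b" for u
  proof (cases "u \<in> S")
    case False
    then have "R\<^sup>2 \<le> nrm_sq d (\<lambda>i. u i - u0 i)" using u by (auto simp: S_def)
    then have "\<nu> / 2 * nrm_sq d (\<lambda>i. us i - u0 i) \<le> \<nu> / 2 * nrm_sq d (\<lambda>i. u i - u0 i)"
      using R' \<nu> by (intro mult_left_mono) auto
    then show ?thesis using v(2)[OF usS] min[OF u] by linarith
  qed (rule v(2))
  then show ?thesis using that[of v] v(1) by (auto simp: S_def)
qed

lemma problem_settingD:
  assumes "problem_setting d s B b G gG L \<mu> ustar"
  shows "\<exists>i<s. \<exists>j<d. B i j \<noteq> 0" "\<mu> < L" "ustar \<in> vecs d" "mv s d B ustar = b"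
    "\<And>u. u \<in> vecs d \<Longrightarrow> mv s d B u = b \<Longrightarrow> G ustar \<le> G u"
    "\<And>u. u \<in> vecs d \<Longrightarrow> gG u \<in> vecs d"
    "\<And>u v. u \<in> vecs d \<Longrightarrow> v \<in> vecs d \<Longrightarrow>
      G v \<le> G u + ip d (gG u) (\<lambda>i. v i - u i) + L / 2 * nrm_sq d (\<lambda>i. v i - u i)"
    "\<And>u v. u \<in> vecs d \<Longrightarrow> v \<in> vecs d \<Longrightarrow>
      G u + ip d (gG u) (\<lambda>i. v i - u i) + \<mu> / 2 * nrm_sq d (\<lambda>i. v i - u i) \<le> G v"
proof -
  show "G v \<le> G u + ip d (gG u) (\<lambda>i. v i - u i) + L / 2 * nrm_sq d (\<lambda>i. v i - u i)"
    if "u \<in> vecs d" "v \<in> vecs d" for u v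
  proof -
    have "G v - G u - ip d (gG u) (\<lambda>i. v i - u i) \<le> L / 2 * nrm_sq d (\<lambda>i. v i - u i)"
      using assms that unfolding problem_setting_def L_smooth_def by blast
    then show ?thesis by linarith
  qed
qed (use assms in \<open>auto simp: problem_setting_def L_smooth_def has_grad_def strongly_convex_def\<close>)

section \<open>The two cases of the theorem\<close>

lemma strongly_convex_case:
  assumes ps: "problem_setting d s B b G gG L \<mu> ustar" and mu: "\<mu> > 0" and u0: "u0 \<in> vecs d"
  shows "\<exists>\<epsilon>0>0. \<forall>\<epsilon>. 0 < \<epsilon> \<and> \<epsilon> < \<epsilon>0 \<longrightarrow>
        (\<exists>\<eta> \<theta> \<alpha> \<tau> N. \<eta> > 0 \<and> \<theta> > 0 \<and> \<alpha> > 0 \<and> 0 < \<tau> \<and> \<tau> < 1 \<and>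
           real N \<le> 146 * kappa_B s d B * sqrt (L / \<mu>) * ln (1 / \<epsilon>) \<and>
           nrm_sq d (\<lambda>i. apapc s d B b gG \<eta> \<theta> \<alpha> \<tau> u0 N i - ustar i) \<le> \<epsilon>)"
proof -
  note P = problem_settingD[OF ps]
  define K where "K = (2 + L / \<mu>) * nrm_sq d (\<lambda>i. u0 i - ustar i)
    + kappa_B s d B / (2 * \<mu> * L) * nrm_sq d (gG ustar)"
  \<comment> \<open>The constant in the iteration bound must not depend on the problem, so the
    initial error \<open>K\<close> is absorbed by the threshold: with \<open>p = 2\<close> one
    factor \<epsilon> cancels \<open>K\<close>.\<close>
  define \<epsilon>0 where "\<epsilon>0 = min (exp (-1)) (1 / (\<bar>K\<bar> + 1))"
  have "0 < \<epsilon>0" by (simp add: \<epsilon>0_def)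
  moreover have "\<exists>\<eta> \<theta> \<alpha> \<tau> N. \<eta> > 0 \<and> \<theta> > 0 \<and> \<alpha> > 0 \<and> 0 < \<tau> \<and> \<tau> < 1 \<and>
           real N \<le> 146 * kappa_B s d B * sqrt (L / \<mu>) * ln (1 / \<epsilon>) \<and>
           nrm_sq d (\<lambda>i. apapc s d B b gG \<eta> \<theta> \<alpha> \<tau> u0 N i - ustar i) \<le> \<epsilon>"
    if \<epsilon>: "0 < \<epsilon>" "\<epsilon> < \<epsilon>0" for \<epsilon>
  proof -
    have \<epsilon>': "\<epsilon> \<le> exp (-1)" "\<epsilon> < 1 / (\<bar>K\<bar> + 1)" using \<epsilon> by (auto simp: \<epsilon>0_def)
    obtain \<eta> \<theta> \<alpha> \<tau> N where pos: "\<eta> > 0" "\<theta> > 0" "\<alpha> > 0" "0 < \<tau>" "\<tau> < 1"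
      and N: "real N \<le> (12 * real 2 + 1) * kappa_B s d B * sqrt (L / \<mu>) * ln (1 / \<epsilon>)"
      and "apapc s d B b gG \<eta> \<theta> \<alpha> \<tau> u0 N \<in> vecs d"
      and e: "nrm_sq d (\<lambda>i. apapc s d B b gG \<eta> \<theta> \<alpha> \<tau> u0 N i - ustar i) \<le> K * \<epsilon> ^ 2"
      using apapc_converges[OF P(1) mu P(2,6-8,3-5) u0 \<epsilon>(1) \<epsilon>'(1), where p = 2]
      unfolding K_def .
    have "\<epsilon> * (\<bar>K\<bar> + 1) < 1" using \<epsilon>'(2) by (simp add: less_divide_eq)
    moreover have "\<epsilon> * K \<le> \<epsilon> * (\<bar>K\<bar> + 1)" using \<epsilon> by (intro mult_left_mono) auto
    ultimately have "\<epsilon> * K \<le> 1" by linarith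
    then have "(\<epsilon> * K) * \<epsilon> \<le> 1 * \<epsilon>" using \<epsilon> by (intro mult_right_mono) auto
    then have "K * \<epsilon> ^ 2 \<le> \<epsilon>" by (simp add: power2_eq_square mult_ac)
    then have "nrm_sq d (\<lambda>i. apapc s d B b gG \<eta> \<theta> \<alpha> \<tau> u0 N i - ustar i) \<le> \<epsilon>" using e by linarith
    moreover have "real N \<le> 146 * kappa_B s d B * sqrt (L / \<mu>) * ln (1 / \<epsilon>)"
    proof (rule order_trans[OF N], intro mult_right_mono)
      have "exp (-1) < (1::real)" by simp
      then have "\<epsilon> \<le> 1" using \<epsilon>'(1) by linarith
      then show "0 \<le> ln (1 / \<epsilon>)" using \<epsilon>(1) by simp
      show "0 \<le> kappa_B s d B" by (simp add: kappa_B_def)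
      show "0 \<le> sqrt (L / \<mu>)" using mu P(2) by simp
    qed simp
    ultimately show ?thesis using pos by blast
  qed
  ultimately show ?thesis by blast
qed

lemma convex_case:
  assumes ps: "problem_setting d s B b G gG L 0 ustar" and u0: "u0 \<in> vecs d"
    and R: "R > 0" "nrm_sq d (\<lambda>i. u0 i - ustar i) \<le> R\<^sup>2"
  shows "\<exists>\<epsilon>0>0. \<forall>\<epsilon>. 0 < \<epsilon> \<and> \<epsilon> < \<epsilon>0 \<longrightarrow>
        (\<exists>\<eta> \<theta> \<alpha> \<tau> N. \<eta> > 0 \<and> \<theta> > 0 \<and> \<alpha> > 0 \<and> 0 < \<tau> \<and> \<tau> < 1 \<and>
           real N \<le> 146 * kappa_B s d B * sqrt (L * R\<^sup>2 / \<epsilon>) * ln (1 / \<epsilon>) \<and>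
           (let uN = apapc s d B b (\<lambda>u i. gG u i + \<epsilon> / R\<^sup>2 * (u i - u0 i)) \<eta> \<theta> \<alpha> \<tau> u0 N in
              G uN - G ustar \<le> \<epsilon> \<and>
              nrm_sq s (\<lambda>i. mv s d B uN i - b i) \<le> 146 * (sigma_max s d B)\<^sup>2 * \<epsilon>\<^sup>2))"
proof -
  note P = problem_settingD[OF ps]
  have L: "0 < L" using P(2) by simp
  have lower: "G u + ip d (gG u) (\<lambda>i. v i - u i) \<le> G v" if "u \<in> vecs d" "v \<in> vecs d" for u v
    using P(8)[OF that] by simp
  have \<kappa>0: "0 \<le> kappa_B s d B" by (simp add: kappa_B_def)
  \<comment> \<open>The minimiser \<open>v\<close> of the regularised problem varies with
    \<epsilon>, but stays within distance R of \<open>u0\<close>. So \<open>Q\<close> and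
    \<open>Q'\<close> bound the squared gradients of \<open>G\<close> and of the regularised
    function at \<open>v\<close> uniformly, and \<open>M / \<epsilon>\<close> bounds the initial
    error.\<close>
  define Q where "Q = 2 * L\<^sup>2 * R\<^sup>2 + 2 * nrm_sq d (gG u0)"
  define Q' where "Q' = 2 * Q + 2 * L\<^sup>2 * R\<^sup>2"
  define M where "M = R\<^sup>2 * (4 * L * R\<^sup>2 + kappa_B s d B / (2 * L) * Q')"
  have Q0: "0 \<le> Q" "0 \<le> Q'" by (simp_all add: Q_def Q'_def)
  have M0: "0 \<le> M" using Q0 L \<kappa>0 by (simp add: M_def)
  \<comment> \<open>In turn: a logarithm of at least 1, \<open>\<nu> < L\<close>, absorption of
    \<open>M\<close>, and absorption of the constants in the objective gap.\<close>
  define \<epsilon>0 where "\<epsilon>0 = min (min (exp (-1)) (L * R\<^sup>2)) (min (1 / (M + 1)) (1 / (Q + 1 + L)))"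
  have "0 < \<epsilon>0" using L R M0 Q0 by (simp add: \<epsilon>0_def)
  moreover have "\<exists>\<eta> \<theta> \<alpha> \<tau> N. \<eta> > 0 \<and> \<theta> > 0 \<and> \<alpha> > 0 \<and> 0 < \<tau> \<and> \<tau> < 1 \<and>
           real N \<le> 146 * kappa_B s d B * sqrt (L * R\<^sup>2 / \<epsilon>) * ln (1 / \<epsilon>) \<and>
           (let uN = apapc s d B b (\<lambda>u i. gG u i + \<epsilon> / R\<^sup>2 * (u i - u0 i)) \<eta> \<theta> \<alpha> \<tau> u0 N in
              G uN - G ustar \<le> \<epsilon> \<and>
              nrm_sq s (\<lambda>i. mv s d B uN i - b i) \<le> 146 * (sigma_max s d B)\<^sup>2 * \<epsilon>\<^sup>2)"
    if \<epsilon>: "0 < \<epsilon>" "\<epsilon> < \<epsilon>0" for \<epsilon>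
  proof -
    have \<epsilon>': "\<epsilon> \<le> exp (-1)" "\<epsilon> < L * R\<^sup>2" "\<epsilon> < 1 / (M + 1)" "\<epsilon> < 1 / (Q + 1 + L)"
      using \<epsilon> by (auto simp: \<epsilon>0_def)
    have "exp (-1) < (1::real)" by simp
    then have \<epsilon>1: "\<epsilon> < 1" using \<epsilon>'(1) by linarith
    define \<nu> where "\<nu> = \<epsilon> / R\<^sup>2"
    have \<nu>: "0 < \<nu>" "\<nu> < L" using \<epsilon> \<epsilon>' R by (auto simp: \<nu>_def divide_less_eq)
    have \<nu>R: "\<nu> * R\<^sup>2 = \<epsilon>" using R by (simp add: \<nu>_def)
    define F where "F u = G u + \<nu> / 2 * nrm_sq d (\<lambda>i. u i - u0 i)" for u
    define gF where "gF = (\<lambda>u i. gG u i + \<nu> * (u i - u0 i))"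
    obtain v where v: "v \<in> vecs d" "mv s d B v = b" "nrm_sq d (\<lambda>i. v i - u0 i) \<le> R\<^sup>2"
      and vmin: "\<And>u. u \<in> vecs d \<Longrightarrow> mv s d B u = b \<Longrightarrow> F v \<le> F u"
      using regularised_minimiser[OF smooth_convex_continuous[OF P(7) lower] P(3-5) u0 R(2)
        less_imp_le[OF \<nu>(1)]]
      unfolding F_def by blast
    have gFV: "gF u \<in> vecs d" if "u \<in> vecs d" for u
      unfolding gF_def by (intro vecs_closed P(6) that u0)
    \<comment> \<open>The quadratic regulariser equals its second-order expansion, so both the
      smoothness and the strong convexity constant shift by exactly \<nu>.\<close>
    have exp: "F w = F u + ip d (gF u) (\<lambda>i. w i - u i) + \<nu> / 2 * nrm_sq d (\<lambda>i. w i - u i)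
        + (G w - G u - ip d (gG u) (\<lambda>i. w i - u i))" for u w
      unfolding F_def gF_def ip_left(1,3) nrm_sq_shift[of d w u0 u] by (simp add: distrib_left)
    have upF: "F w \<le> F u + ip d (gF u) (\<lambda>i. w i - u i) + (L + \<nu>) / 2 * nrm_sq d (\<lambda>i. w i - u i)"
      if "u \<in> vecs d" "w \<in> vecs d" for u w
      using exp[of w u] P(7)[OF that] by (simp add: add_divide_distrib distrib_right)
    have strF: "F u + ip d (gF u) (\<lambda>i. w i - u i) + \<nu> / 2 * nrm_sq d (\<lambda>i. w i - u i) \<le> F w"
      if "u \<in> vecs d" "w \<in> vecs d" for u w
      using exp[of w u] lower[OF that] by simp
    have \<nu>L: "\<nu> < L + \<nu>" using L by simp
    \<comment> \<open>Of the six powers one cancels the \<open>1 / \<epsilon>\<close> in the initial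
      error, one absorbs \<open>M\<close>, and four remain.\<close>
    obtain \<eta> \<theta> \<alpha> \<tau> N where pos: "\<eta> > 0" "\<theta> > 0" "\<alpha> > 0" "0 < \<tau>" "\<tau> < 1"
      and N: "real N \<le> (12 * real 6 + 1) * kappa_B s d B * sqrt ((L + \<nu>) / \<nu>) * ln (1 / \<epsilon>)"
      and uNV: "apapc s d B b gF \<eta> \<theta> \<alpha> \<tau> u0 N \<in> vecs d"
      and e: "nrm_sq d (\<lambda>i. apapc s d B b gF \<eta> \<theta> \<alpha> \<tau> u0 N i - v i) \<le>
        ((2 + (L + \<nu>) / \<nu>) * nrm_sq d (\<lambda>i. u0 i - v i)
          + kappa_B s d B / (2 * \<nu> * (L + \<nu>)) * nrm_sq d (gF v)) * \<epsilon> ^ 6"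
      using apapc_converges[OF P(1) \<nu>(1) \<nu>L gFV upF strF v(1,2) vmin u0 \<epsilon>(1) \<epsilon>'(1), where p = 6] .
    define uN where "uN = apapc s d B b gF \<eta> \<theta> \<alpha> \<tau> u0 N"
    have gQ: "nrm_sq d (gG v) \<le> Q"
    proof -
      have "nrm_sq d (\<lambda>i. gG v i - gG u0 i) \<le> 2 * L * (G v - G u0 - ip d (gG u0) (\<lambda>i. v i - u0 i))"
        by (rule smooth_convex_gradient_gap[OF L P(6,7) lower v(1) u0])
      also have "\<dots> \<le> 2 * L * (L / 2 * R\<^sup>2)"
      proof (intro mult_left_mono)
        have "L / 2 * nrm_sq d (\<lambda>i. v i - u0 i) \<le> L / 2 * R\<^sup>2"
          using L v(3) by (intro mult_left_mono) auto
        then show "G v - G u0 - ip d (gG u0) (\<lambda>i. v i - u0 i) \<le> L / 2 * R\<^sup>2"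
          using P(7)[OF u0 v(1)] by linarith
      qed (use L in simp)
      finally have "nrm_sq d (\<lambda>i. gG v i - gG u0 i) \<le> L\<^sup>2 * R\<^sup>2" by (simp add: power2_eq_square)
      moreover have "nrm_sq d (gG v) \<le> 2 * nrm_sq d (\<lambda>i. gG v i - gG u0 i) + 2 * nrm_sq d (gG u0)"
        using nrm_sq_add_le[of d "\<lambda>i. gG v i - gG u0 i" "gG u0"] by simp
      ultimately show ?thesis unfolding Q_def by simp
    qed
    have gQ': "nrm_sq d (gF v) \<le> Q'"
    proof -
      have "nrm_sq d (gF v) \<le> 2 * nrm_sq d (gG v) + 2 * (\<nu>\<^sup>2 * nrm_sq d (\<lambda>i. v i - u0 i))"
        unfolding gF_def using nrm_sq_add_le[of d "gG v" "\<lambda>i. \<nu> * (v i - u0 i)"]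
        by (simp only: nrm_sq_scale)
      moreover have "\<nu>\<^sup>2 * nrm_sq d (\<lambda>i. v i - u0 i) \<le> L\<^sup>2 * R\<^sup>2"
        using \<nu> v(3) by (intro mult_mono power_mono) auto
      ultimately show ?thesis using gQ unfolding Q'_def by linarith
    qed
    have D: "nrm_sq d (\<lambda>i. u0 i - v i) \<le> R\<^sup>2" using v(3) by (simp add: nrm_sq_diff ip_commute)
    have "(2 + (L + \<nu>) / \<nu>) * nrm_sq d (\<lambda>i. u0 i - v i)
          + kappa_B s d B / (2 * \<nu> * (L + \<nu>)) * nrm_sq d (gF v)
        \<le> 4 * L / \<nu> * R\<^sup>2 + kappa_B s d B / (2 * \<nu> * L) * Q'"
    proof (intro add_mono mult_mono D gQ')
      have "2 + (L + \<nu>) / \<nu> = (3 * \<nu> + L) / \<nu>" using \<nu> by (simp add: field_simps)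
      also have "\<dots> \<le> 4 * L / \<nu>" using \<nu> by (intro divide_right_mono) auto
      finally show "2 + (L + \<nu>) / \<nu> \<le> 4 * L / \<nu>" .
      show "kappa_B s d B / (2 * \<nu> * (L + \<nu>)) \<le> kappa_B s d B / (2 * \<nu> * L)"
        using \<kappa>0 \<nu> L by (intro divide_left_mono mult_left_mono) auto
    qed (use \<nu> L \<kappa>0 in auto)
    also have "\<dots> = M / \<epsilon>"
      using R \<epsilon> L by (simp add: M_def \<nu>_def field_simps)
    finally have "nrm_sq d (\<lambda>i. uN i - v i) \<le> M / \<epsilon> * \<epsilon> ^ 6"
      using e \<epsilon> unfolding uN_def[symmetric] by (meson mult_right_mono order_trans zero_le_power less_imp_le)
    also have "\<dots> = (\<epsilon> * M) * \<epsilon> ^ 4" using \<epsilon> by (simp add: eval_nat_numeral)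
    also have "\<dots> \<le> 1 * \<epsilon> ^ 4"
    proof (intro mult_right_mono)
      have "\<epsilon> * (M + 1) < 1" using \<epsilon>'(3) M0 by (simp add: less_divide_eq)
      then show "\<epsilon> * M \<le> 1" using \<epsilon> by (simp add: distrib_left)
    qed simp
    finally have \<delta>: "nrm_sq d (\<lambda>i. uN i - v i) \<le> \<epsilon>\<^sup>2 * \<epsilon>\<^sup>2" by (simp add: eval_nat_numeral mult.assoc)
    have sq1: "\<epsilon>\<^sup>2 \<le> 1" using \<epsilon> \<epsilon>1 by (simp add: power_le_one)
    have \<delta>2: "nrm_sq d (\<lambda>i. uN i - v i) \<le> \<epsilon>\<^sup>2"
      using \<delta> mult_left_mono[OF sq1, of "\<epsilon>\<^sup>2"] by simp
    have "G uN - G v \<le> \<epsilon> / 2"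
    proof -
      \<comment> \<open>The gradient at \<open>v\<close> need not vanish, so the linear term is
        split with weights \<epsilon> and \<open>1 / \<epsilon>\<close>; the squared distance
        \<open>\<epsilon> ^ 4\<close> makes both halves of order
        \<open>\<epsilon> ^ 2\<close>.\<close>
      have "ip d (gG v) (\<lambda>i. uN i - v i) = ip d (\<lambda>i. \<epsilon> * gG v i) (\<lambda>i. 1 / \<epsilon> * (uN i - v i))"
        unfolding ip_left(3) ip_right(3) using \<epsilon> by simp
      also have "\<dots> \<le> (nrm_sq d (\<lambda>i. \<epsilon> * gG v i) + nrm_sq d (\<lambda>i. 1 / \<epsilon> * (uN i - v i))) / 2"
        by (rule ip_le_nrm_sq)
      also have "\<dots> = (\<epsilon>\<^sup>2 * nrm_sq d (gG v) + nrm_sq d (\<lambda>i. uN i - v i) / \<epsilon>\<^sup>2) / 2"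
        unfolding nrm_sq_scale by (simp add: power_divide)
      also have "\<dots> \<le> (\<epsilon>\<^sup>2 * Q + \<epsilon>\<^sup>2) / 2"
        using \<delta> \<epsilon> by (intro divide_right_mono add_mono mult_left_mono gQ) (auto simp: divide_le_eq)
      finally have "ip d (gG v) (\<lambda>i. uN i - v i) \<le> (\<epsilon>\<^sup>2 * Q + \<epsilon>\<^sup>2) / 2" .
      moreover have "L / 2 * nrm_sq d (\<lambda>i. uN i - v i) \<le> L / 2 * \<epsilon>\<^sup>2"
        using L \<delta>2 by (intro mult_left_mono) auto
      ultimately have "G uN - G v \<le> (\<epsilon>\<^sup>2 * Q + \<epsilon>\<^sup>2) / 2 + L / 2 * \<epsilon>\<^sup>2"
        using P(7)[OF v(1) uNV[folded uN_def]] by linarith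
      also have "\<dots> = \<epsilon> * (\<epsilon> * (Q + 1 + L)) / 2"
        by (simp add: power2_eq_square algebra_simps)
      also have "\<dots> \<le> \<epsilon> * 1 / 2"
        using \<epsilon> \<epsilon>'(4) Q0 L by (intro divide_right_mono mult_left_mono) (auto simp: less_divide_eq)
      finally show ?thesis by simp
    qed
    \<comment> \<open>Regularisation bias: \<open>G v \<le> F v \<le> F ustar\<close>, and the
      penalty at \<open>ustar\<close> is at most \<open>\<nu> * R\<^sup>2 / 2\<close>.\<close>
    moreover have "G v \<le> G ustar + \<epsilon> / 2"
    proof -
      have "nrm_sq d (\<lambda>i. ustar i - u0 i) \<le> R\<^sup>2" using R by (simp add: nrm_sq_diff ip_commute)
      then have "\<nu> / 2 * nrm_sq d (\<lambda>i. ustar i - u0 i) \<le> \<nu> / 2 * R\<^sup>2"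
        using \<nu> by (intro mult_left_mono) auto
      moreover have "0 \<le> \<nu> / 2 * nrm_sq d (\<lambda>i. v i - u0 i)" using \<nu> by simp
      ultimately show ?thesis using vmin[OF P(3,4)] \<nu>R unfolding F_def by simp
    qed
    ultimately have G: "G uN - G ustar \<le> \<epsilon>" by linarith
    have Bd: "nrm_sq s (\<lambda>i. mv s d B uN i - b i) \<le> 146 * (sigma_max s d B)\<^sup>2 * \<epsilon>\<^sup>2"
    proof -
      have "(\<lambda>i. uN i - v i) \<in> vecs d" unfolding uN_def by (intro vecs_closed uNV v(1))
      from singular_value_bounds(3)[OF P(1) this]
      have "nrm_sq s (\<lambda>i. mv s d B uN i - b i) \<le> (sigma_max s d B)\<^sup>2 * nrm_sq d (\<lambda>i. uN i - v i)"
        by (simp add: mv_linear v(2))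
      also have "\<dots> \<le> (146 * (sigma_max s d B)\<^sup>2) * \<epsilon>\<^sup>2" by (intro mult_mono \<delta>2) simp_all
      finally show ?thesis .
    qed
    have Nb: "real N \<le> 146 * kappa_B s d B * sqrt (L * R\<^sup>2 / \<epsilon>) * ln (1 / \<epsilon>)"
    proof -
      have "(L + \<nu>) / \<nu> \<le> 4 * (L * R\<^sup>2 / \<epsilon>)"
      proof -
        have "(L + \<nu>) / \<nu> \<le> 4 * L / \<nu>" using \<nu> by (intro divide_right_mono) auto
        then show ?thesis by (simp add: \<nu>_def)
      qed
      then have "sqrt ((L + \<nu>) / \<nu>) \<le> sqrt (4 * (L * R\<^sup>2 / \<epsilon>))" by (rule real_sqrt_le_mono)
      also have "\<dots> = 2 * sqrt (L * R\<^sup>2 / \<epsilon>)" by (simp only: real_sqrt_mult real_sqrt_four)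
      finally have "(12 * real 6 + 1) * kappa_B s d B * sqrt ((L + \<nu>) / \<nu>) * ln (1 / \<epsilon>)
          \<le> (12 * real 6 + 1) * kappa_B s d B * (2 * sqrt (L * R\<^sup>2 / \<epsilon>)) * ln (1 / \<epsilon>)"
        using \<kappa>0 \<epsilon> \<epsilon>1 by (intro mult_right_mono mult_left_mono) auto
      also have "\<dots> = 146 * kappa_B s d B * sqrt (L * R\<^sup>2 / \<epsilon>) * ln (1 / \<epsilon>)" by simp
      finally show ?thesis using N by linarith
    qed
    show ?thesis
      using pos Nb G Bd unfolding Let_def uN_def gF_def \<nu>_def by blast
  qed
  ultimately show ?thesis by blast
qed

theorem theorem2p4:
  shows "\<exists>C>0.
   (\<forall>d s B b G gG L \<mu> ustar u0 (R::real).
      problem_setting d s B b G gG L \<mu> ustar \<and> \<mu> > 0 \<and>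
      u0 \<in> vecs d \<and> R > 0 \<and> nrm_sq d (\<lambda>i. u0 i - ustar i) \<le> R\<^sup>2 \<longrightarrow>
      (\<exists>\<epsilon>0>0. \<forall>\<epsilon>. 0 < \<epsilon> \<and> \<epsilon> < \<epsilon>0 \<longrightarrow>
        (\<exists>\<eta> \<theta> \<alpha> \<tau> N. \<eta> > 0 \<and> \<theta> > 0 \<and> \<alpha> > 0 \<and> 0 < \<tau> \<and> \<tau> < 1 \<and>
           real N \<le> C * kappa_B s d B * sqrt (L / \<mu>) * ln (1 / \<epsilon>) \<and>
           nrm_sq d (\<lambda>i. apapc s d B b gG \<eta> \<theta> \<alpha> \<tau> u0 N i - ustar i) \<le> \<epsilon>)))
   \<and>
   (\<forall>d s B b G gG L ustar u0 (R::real).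
      problem_setting d s B b G gG L 0 ustar \<and>
      u0 \<in> vecs d \<and> R > 0 \<and> nrm_sq d (\<lambda>i. u0 i - ustar i) \<le> R\<^sup>2 \<longrightarrow>
      (\<exists>\<epsilon>0>0. \<forall>\<epsilon>. 0 < \<epsilon> \<and> \<epsilon> < \<epsilon>0 \<longrightarrow>
        (let \<nu> = \<epsilon> / R\<^sup>2;
             gG\<nu> = (\<lambda>u i. gG u i + \<nu> * (u i - u0 i))
         in \<exists>\<eta> \<theta> \<alpha> \<tau> N. \<eta> > 0 \<and> \<theta> > 0 \<and> \<alpha> > 0 \<and> 0 < \<tau> \<and> \<tau> < 1 \<and>
           real N \<le> C * kappa_B s d B * sqrt (L * R\<^sup>2 / \<epsilon>) * ln (1 / \<epsilon>) \<and>
           (let uN = apapc s d B b gG\<nu> \<eta> \<theta> \<alpha> \<tau> u0 N in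
              G uN - G ustar \<le> \<epsilon> \<and>
              nrm_sq s (\<lambda>i. mv s d B uN i - b i) \<le> C * (sigma_max s d B)\<^sup>2 * \<epsilon>\<^sup>2))))"
\<comment> \<open>The constant is \<open>2 * (12 * 6 + 1)\<close>: the rate for
  \<open>p = 6\<close>, doubled by replacing \<open>(L + \<nu>) / \<nu>\<close> with
  \<open>4 * L / \<nu>\<close> under the root. It also exceeds the constants of the other
  bounds.\<close>
proof (rule exI[of _ 146], intro conjI allI impI, goal_cases)
  case (2 d s B b G gG L \<mu> ustar u0 R)
  then show ?case by (intro strongly_convex_case[of d s B b G gG L \<mu> ustar u0]) simp_all
next
  case (3 d s B b G gG L ustar u0 R)
  then show ?case unfolding Let_def
    by (intro convex_case[unfolded Let_def]) simp_all
qed simp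

end
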